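(* Let $A$ be a unital $C^*$-algebra and $E$ a finitely or countably generated Hilbert $A$-module. Let $U$ be a bounded invertible operator on $\ell^2(A)$ and let $Y=\{y_n\}\subset E$ be a modular Riesz basis for $E$. Moreover let $X=\{x_n\}$ be a standard frame for $E$. Then the following assertions are equivalent: (1) $X$ has a unique dual frame. (2) $\mathbf{M}_{U,Y,X}$ is invertible.
   Context: Hilbert $A$-modules are left modules whose $A$-valued inner product is $A$-linear in the first argument. $\ell^2(A)$ is the Hilbert $A$-module of sequences $\{a_n\}$ in $A$ such that $\sum_n a_na_n^*$ converges in norm, with $\langle\{a_n\},\{b_n\}\rangle=\sum_n a_nb_n^*$. Its standard orthonormal basis is $\{e_n\}$, where $e_n$ has $1_A$ in position $n$ and $0$ elsewhere. A sequence $\{x_n\}\subset E$ is a standard frame if there are constants $C,D>0$ such that for every $x\in E$ the series $\sum_n\langle x,x_n\rangle\langle x_n,x\rangle$ converges in norm and $C\langle x,x\rangle\le\sum_n\langle x,x_n\rangle\langle x_n,x\rangle\le D\langle x,x\rangle$. Its analysis operator $T_X:E\to\ell^2(A)$, $T_Xx=\{\langle x,x_n\rangle\}_n$, is adjointable with adjoint $T_X^*(\{a_n\})=\sum_n a_nx_n$. A dual frame of $X$ is a standard frame $\{z_n\}$ of $E$ for which the reconstruction formula $x=\sum_n\langle x,z_n\rangle x_n=\sum_n\langle x,x_n\rangle z_n$ holds for all $x\in E$; the canonical dual $\{S_X^{-1}x_n\}$, where $S_X=T_X^*T_X$, is always one. A sequence $\{y_n\}\subset E$ is a modular Riesz basis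 for $E$ if there is an adjointable and invertible operator $V:\ell^2(A)\to E$ with $V(e_n)=y_n$ for each $n$; it is in particular a standard frame. The generalized multiplier with symbol $U$ is $\mathbf{M}_{U,Y,X}=T_Y^*UT_X:E\to E$. Invertible means bijective with bounded inverse. *)

theory Defs
  imports "HOL-Analysis.Analysis"
begin

section \<open>Unital C*-algebras\<close>

text \<open>As usual for unital algebras in the library, \<open>0 \<noteq> 1\<close> and \<open>norm 1 = 1\<close> are part of the
  superclass; for a nonzero unital C*-algebra the latter follows from the C*-identity.\<close>

class unital_cstar_algebra = banach + real_normed_algebra_1 +
  fixes scaleC :: "complex \<Rightarrow> 'a \<Rightarrow> 'a" (infixr "*\<^sub>C" 75)
    and star :: "'a \<Rightarrow> 'a"
  assumes scaleC_add_right: "c *\<^sub>C (x + y) = c *\<^sub>C x + c *\<^sub>C y"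
    and scaleC_add_left: "(c + d) *\<^sub>C x = c *\<^sub>C x + d *\<^sub>C x"
    and scaleC_scaleC: "c *\<^sub>C (d *\<^sub>C x) = (c * d) *\<^sub>C x"
    and scaleC_of_real: "complex_of_real r *\<^sub>C x = r *\<^sub>R x"
    and scaleC_mult_left: "(c *\<^sub>C x) * y = c *\<^sub>C (x * y)"
    and scaleC_mult_right: "x * (c *\<^sub>C y) = c *\<^sub>C (x * y)"
    and norm_scaleC: "norm (c *\<^sub>C x) = cmod c * norm x"
    and star_add: "star (x + y) = star x + star y"
    and star_scaleC: "star (c *\<^sub>C x) = cnj c *\<^sub>C star x"
    and star_mult: "star (x * y) = star y * star x"
    and star_star: "star (star x) = x"
    and cstar_identity: "norm (star x * x) = (norm x)\<^sup>2"

definition positive_elem :: "'a::unital_cstar_algebra \<Rightarrow> bool" where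
  "positive_elem a \<longleftrightarrow> (\<exists>b. a = star b * b)"

definition cstar_le :: "'a::unital_cstar_algebra \<Rightarrow> 'a \<Rightarrow> bool" (infix "\<sqsubseteq>" 50) where
  "a \<sqsubseteq> b \<longleftrightarrow> positive_elem (b - a)"

section \<open>Hilbert modules\<close>

text \<open>Left Hilbert \<open>A\<close>-modules, with inner product \<open>A\<close>-linear in the first argument. Completeness
  in the norm given by the inner product is the class \<open>banach\<close> together with \<open>norm_eq\<close>. As \<open>A\<close> is
  unital, the complex scalar action is \<open>(c *\<^sub>C 1) \<cdot> x\<close>; \<open>scaleR_eq\<close> identifies its restriction
  to the reals with the real scalar action of the type.\<close>

locale hilbert_module =
  fixes smul :: "'a::unital_cstar_algebra \<Rightarrow> 'e::banach \<Rightarrow> 'e"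
    and ip :: "'e \<Rightarrow> 'e \<Rightarrow> 'a"
  assumes smul_add_right: "smul a (x + y) = smul a x + smul a y"
    and smul_add_left: "smul (a + b) x = smul a x + smul b x"
    and smul_smul: "smul a (smul b x) = smul (a * b) x"
    and smul_one: "smul 1 x = x"
    and scaleR_eq: "r *\<^sub>R x = smul (r *\<^sub>R 1) x"
    and ip_add_left: "ip (x + y) z = ip x z + ip y z"
    and ip_smul_left: "ip (smul a x) y = a * ip x y"
    and ip_star: "star (ip x y) = ip y x"
    and ip_positive: "positive_elem (ip x x)"
    and ip_definite: "ip x x = 0 \<Longrightarrow> x = 0"
    and norm_eq: "norm x = sqrt (norm (ip x x))"

definition module_span :: "('a \<Rightarrow> 'e \<Rightarrow> 'e) \<Rightarrow> 'e set \<Rightarrow> 'e::comm_monoid_add set" where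
  "module_span smul G = {\<Sum>g\<in>F. smul (c g) g | F c. finite F \<and> F \<subseteq> G}"

definition finitely_generated :: "('a \<Rightarrow> 'e \<Rightarrow> 'e::banach) \<Rightarrow> bool" where
  "finitely_generated smul \<longleftrightarrow> (\<exists>G. finite G \<and> module_span smul G = UNIV)"

definition countably_generated :: "('a \<Rightarrow> 'e \<Rightarrow> 'e::banach) \<Rightarrow> bool" where
  "countably_generated smul \<longleftrightarrow> (\<exists>G. countable G \<and> closure (module_span smul G) = UNIV)"

section \<open>The Hilbert module of square-summable sequences\<close>

definition l2 :: "(nat \<Rightarrow> 'a::unital_cstar_algebra) set" where
  "l2 = {a. summable (\<lambda>n. a n * star (a n))}"

definition l2_ip :: "(nat \<Rightarrow> 'a::unital_cstar_algebra) \<Rightarrow> (nat \<Rightarrow> 'a) \<Rightarrow> 'a" where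
  "l2_ip a b = (\<Sum>n. a n * star (b n))"

definition l2_norm :: "(nat \<Rightarrow> 'a::unital_cstar_algebra) \<Rightarrow> real" where
  "l2_norm a = sqrt (norm (l2_ip a a))"

definition l2_unit :: "nat \<Rightarrow> nat \<Rightarrow> 'a::unital_cstar_algebra" where
  "l2_unit n = (\<lambda>k. if k = n then 1 else 0)"

section \<open>Operators\<close>

text \<open>Since \<open>l2\<close> is a set and a module \<open>E\<close> is a type, boundedness and invertibility take the
  carriers \<open>H\<close>, \<open>K\<close> and their norms \<open>nH\<close>, \<open>nK\<close> as arguments; for \<open>E\<close> these are \<open>UNIV\<close> and
  \<open>norm\<close>. Values of an operator outside its carrier are irrelevant.\<close>

definition bounded_op :: "'x set \<Rightarrow> ('x \<Rightarrow> real) \<Rightarrow> ('y \<Rightarrow> real) \<Rightarrow> ('x \<Rightarrow> 'y) \<Rightarrow> bool" where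
  "bounded_op H nH nK T \<longleftrightarrow> (\<exists>B. \<forall>x\<in>H. nK (T x) \<le> B * nH x)"

definition invertible_op ::
    "'x set \<Rightarrow> ('x \<Rightarrow> real) \<Rightarrow> 'y set \<Rightarrow> ('y \<Rightarrow> real) \<Rightarrow> ('x \<Rightarrow> 'y) \<Rightarrow> bool" where
  "invertible_op H nH K nK T \<longleftrightarrow>
     bij_betw T H K \<and> bounded_op K nK nH (the_inv_into H T)"

text \<open>Bounded operators on \<open>l2\<close> are complex linear; \<open>A\<close>-linearity is not required.\<close>

definition l2_bounded_operator ::
    "((nat \<Rightarrow> 'a::unital_cstar_algebra) \<Rightarrow> (nat \<Rightarrow> 'a)) \<Rightarrow> bool" where
  "l2_bounded_operator U \<longleftrightarrow>
     (\<forall>a\<in>l2. U a \<in> l2) \<and>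
     (\<forall>a\<in>l2. \<forall>b\<in>l2. U (\<lambda>n. a n + b n) = (\<lambda>n. U a n + U b n)) \<and>
     (\<forall>c. \<forall>a\<in>l2. U (\<lambda>n. c *\<^sub>C a n) = (\<lambda>n. c *\<^sub>C U a n)) \<and>
     bounded_op l2 l2_norm l2_norm U"

text \<open>Adjointability of \<open>V : l2 \<rightarrow> E\<close>; it implies \<open>A\<close>-linearity and boundedness.\<close>

definition l2_adjointable ::
    "('e \<Rightarrow> 'e \<Rightarrow> 'a::unital_cstar_algebra) \<Rightarrow> ((nat \<Rightarrow> 'a) \<Rightarrow> 'e) \<Rightarrow> bool" where
  "l2_adjointable ip V \<longleftrightarrow>
     (\<exists>W. (\<forall>x. W x \<in> l2) \<and> (\<forall>a\<in>l2. \<forall>x. ip (V a) x = l2_ip a (W x)))"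

section \<open>Frames, Riesz bases and multipliers\<close>

definition standard_frame ::
    "('e \<Rightarrow> 'e \<Rightarrow> 'a::unital_cstar_algebra) \<Rightarrow> (nat \<Rightarrow> 'e) \<Rightarrow> bool" where
  "standard_frame ip X \<longleftrightarrow>
     (\<exists>C>0. \<exists>D>0. \<forall>x.
        summable (\<lambda>n. ip x (X n) * ip (X n) x) \<and>
        C *\<^sub>R ip x x \<sqsubseteq> (\<Sum>n. ip x (X n) * ip (X n) x) \<and>
        (\<Sum>n. ip x (X n) * ip (X n) x) \<sqsubseteq> D *\<^sub>R ip x x)"

definition dual_frame ::
    "('a \<Rightarrow> 'e \<Rightarrow> 'e) \<Rightarrow> ('e::banach \<Rightarrow> 'e \<Rightarrow> 'a::unital_cstar_algebra) \<Rightarrow>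
      (nat \<Rightarrow> 'e) \<Rightarrow> (nat \<Rightarrow> 'e) \<Rightarrow> bool" where
  "dual_frame smul ip X Z \<longleftrightarrow>
     standard_frame ip Z \<and>
     (\<forall>x. (\<lambda>n. smul (ip x (Z n)) (X n)) sums x \<and>
          (\<lambda>n. smul (ip x (X n)) (Z n)) sums x)"

definition modular_riesz_basis ::
    "('e::banach \<Rightarrow> 'e \<Rightarrow> 'a::unital_cstar_algebra) \<Rightarrow> (nat \<Rightarrow> 'e) \<Rightarrow> bool" where
  "modular_riesz_basis ip Y \<longleftrightarrow>
     (\<exists>V. l2_adjointable ip V \<and> invertible_op l2 l2_norm UNIV norm V \<and>
          (\<forall>n. V (l2_unit n) = Y n))"

definition analysis_op :: "('e \<Rightarrow> 'e \<Rightarrow> 'a) \<Rightarrow> (nat \<Rightarrow> 'e) \<Rightarrow> 'e \<Rightarrow> nat \<Rightarrow> 'a" where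
  "analysis_op ip X x = (\<lambda>n. ip x (X n))"

text \<open>The adjoint \<open>T\<^sub>X\<^sup>*\<close> of the analysis operator.\<close>

definition synthesis_op :: "('a \<Rightarrow> 'e \<Rightarrow> 'e::banach) \<Rightarrow> (nat \<Rightarrow> 'e) \<Rightarrow> (nat \<Rightarrow> 'a) \<Rightarrow> 'e" where
  "synthesis_op smul X a = (\<Sum>n. smul (a n) (X n))"

definition multiplier ::
    "('a \<Rightarrow> 'e \<Rightarrow> 'e) \<Rightarrow> ('e::banach \<Rightarrow> 'e \<Rightarrow> 'a) \<Rightarrow> ((nat \<Rightarrow> 'a) \<Rightarrow> (nat \<Rightarrow> 'a)) \<Rightarrow>
      (nat \<Rightarrow> 'e) \<Rightarrow> (nat \<Rightarrow> 'e) \<Rightarrow> 'e \<Rightarrow> 'e" where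
  "multiplier smul ip U Y X = synthesis_op smul Y \<circ> U \<circ> analysis_op ip X"

end

theory Submission
  imports Defs
begin

text \<open>Synthesis by the Riesz basis \<open>Y\<close> and the operator \<open>U\<close> are both invertible, so the multiplier is
  invertible if and only if the analysis operator \<open>T\<close> of \<open>X\<close> maps \<open>E\<close> onto \<open>l2\<close>; it is always bounded
  below. The frame operator \<open>S = T\<^sup>* T\<close> is invertible and \<open>T S\<^sup>-\<^sup>1 T\<^sup>*\<close> is a projection onto the range of
  \<open>T\<close> with kernel \<open>ker T\<^sup>*\<close>, so \<open>T\<close> is onto if and only if \<open>T\<^sup>*\<close> is injective. If \<open>T\<^sup>*\<close> is injective,
  then \<open>T\<^sup>* T\<^sub>Z = 1\<close> determines the dual frame \<open>Z\<close>. If \<open>T\<^sup>* d = 0\<close> with \<open>d \<noteq> 0\<close>, then adding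
  \<open>d\<^sub>n\<^sup>* w\<close> to the canonical dual gives another dual frame, provided that \<open>w\<close> has no annihilator in
  \<open>A\<close>; the vectors of a Riesz basis are of this kind.

  The C*-algebraic input is that elements of the form \<open>b\<^sup>* b\<close> make up a closed convex cone on
  which the norm is monotone.\<close>

section \<open>Positive elements of a unital C*-algebra\<close>

lemma scaleC_diff_right: "c *\<^sub>C (x - y) = c *\<^sub>C x - c *\<^sub>C (y::'a::unital_cstar_algebra)"
  using scaleC_add_right[of c "x - y" y] by simp

lemma scaleC_minus_left: "(- c) *\<^sub>C x = - (c *\<^sub>C (x::'a::unital_cstar_algebra))"
proof -
  have "(-1) *\<^sub>C y = - y" for y :: 'a
    using scaleC_of_real[of "-1" y] by simp
  then show ?thesis using scaleC_scaleC[of "-1" c x] by simp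
qed

lemma star_zero [simp]: "star (0::'a::unital_cstar_algebra) = 0"
  using star_add[of "0::'a" 0] by simp

lemma star_minus: "star (- x) = - star (x::'a::unital_cstar_algebra)"
  using star_add[of x "- x"] by (simp add: eq_neg_iff_add_eq_0 add.commute)

lemma star_diff: "star (x - y) = star x - star (y::'a::unital_cstar_algebra)"
  using star_add[of x "- y"] by (simp add: star_minus)

lemma star_one [simp]: "star (1::'a::unital_cstar_algebra) = 1"
  using star_mult[of "star 1" "1::'a"] by (simp add: star_star)

lemma star_scaleR: "star (r *\<^sub>R x) = r *\<^sub>R star (x::'a::unital_cstar_algebra)"
  by (simp flip: scaleC_of_real add: star_scaleC)

lemma star_of_real [simp]: "star (of_real r) = (of_real r :: 'a::unital_cstar_algebra)"
  by (simp add: of_real_def star_scaleR)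

lemma norm_star [simp]: "norm (star x) = norm (x::'a::unital_cstar_algebra)"
proof -
  have *: "norm x \<le> norm (star x)" for x :: 'a
  proof (cases "x = 0")
    case False
    have "norm x * norm x = norm (star x * x)"
      by (simp add: cstar_identity power2_eq_square)
    also have "\<dots> \<le> norm (star x) * norm x" by (rule norm_mult_ineq)
    finally show ?thesis using False by simp
  qed simp
  show ?thesis using *[of x] *[of "star x"] by (simp add: star_star)
qed

lemma bounded_linear_star: "bounded_linear (star :: 'a::unital_cstar_algebra \<Rightarrow> 'a)"
  by (rule bounded_linear_intro[where K = 1]) (simp_all add: star_add star_scaleR)

lemma star_sum: "star (\<Sum>i\<in>I. f i) = (\<Sum>i\<in>I. star (f i :: 'a::unital_cstar_algebra))"
  by (rule linear_sum[OF bounded_linear.linear[OF bounded_linear_star]])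

lemma star_power: "star (x ^ n) = star (x::'a::unital_cstar_algebra) ^ n"
  by (induction n) (simp_all add: star_mult power_commutes)

lemma norm_mult_star: "norm (x * star x) = (norm (x::'a::unital_cstar_algebra))\<^sup>2"
  using cstar_identity[of "star x"] by (simp add: star_star)

lemma norm_selfadj_power2:
  "star x = x \<Longrightarrow> norm (x * x) = (norm (x::'a::unital_cstar_algebra))\<^sup>2"
  using cstar_identity[of x] by simp

text \<open>Repeated squaring of the C*-identity. It is the usable form of "norm equals spectral
  radius": growth bounds on powers become norm bounds.\<close>

lemma norm_selfadj_power_two_power:
  assumes "star x = x"
  shows "norm (x ^ (2 ^ n)) = norm (x::'a::unital_cstar_algebra) ^ (2 ^ n)"
proof (induction n)
  case (Suc n)
  have "norm (x ^ (2 ^ Suc n)) = norm (x ^ (2 ^ n) * x ^ (2 ^ n))"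
    by (simp add: mult_2 power_add)
  also have "\<dots> = (norm (x ^ (2 ^ n)))\<^sup>2"
    by (rule norm_selfadj_power2) (simp add: star_power assms)
  also have "\<dots> = norm x ^ (2 ^ Suc n)"
    by (simp add: Suc power_even_eq)
  finally show ?case .
qed simp

text \<open>The element \<open>a + ib\<close> is \<open>sqrt r\<close> times a unitary.\<close>

lemma norm_le_of_commuting_squares:
  fixes a b :: "'a::unital_cstar_algebra"
  assumes a: "star a = a" and b: "star b = b" and c: "a * b = b * a"
    and s: "a * a + b * b = of_real r" and r: "r \<ge> 0"
  shows "norm (a * a) \<le> r"
proof -
  define u where "u = a + \<i> *\<^sub>C b"
  have su: "star u = a - \<i> *\<^sub>C b"
    using scaleC_add_left[of "\<i>" "-\<i>" b] scaleC_add_left[of 0 0 b]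
    by (simp add: u_def star_add star_scaleC a b eq_neg_iff_add_eq_0 add.commute)
  have "star u * u = a * a + \<i> *\<^sub>C (a * b) - \<i> *\<^sub>C (b * a) - \<i> *\<^sub>C (\<i> *\<^sub>C (b * b))"
    unfolding su by (simp add: u_def algebra_simps scaleC_mult_left scaleC_mult_right scaleC_add_right
        scaleC_diff_right)
  also have "\<dots> = of_real r"
    using c s scaleC_of_real[of "-1" "b * b"] by (simp add: scaleC_scaleC)
  finally have n0: "star u * u = of_real r" .
  have n: "(norm u)\<^sup>2 = \<bar>r\<bar>"
    using cstar_identity[of u] n0 by simp
  \<comment> \<open>\<open>a\<close> is the real part of \<open>u\<close>, and \<open>u\<close> has
    norm \<open>sqrt r\<close>.\<close>
  have "2 *\<^sub>R a = u + star u"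
    unfolding su by (simp add: u_def scaleR_2)
  then have "2 * norm a = norm (u + star u)"
    by (metis norm_scaleR abs_numeral)
  also have "\<dots> \<le> 2 * norm u"
    using norm_triangle_ineq[of u "star u"] by simp
  finally have "(norm a)\<^sup>2 \<le> \<bar>r\<bar>"
    by (simp flip: n add: power_mono)
  then show ?thesis using r by (simp add: norm_selfadj_power2 a)
qed

text \<open>A spectrum-free description of positivity: the spectrum of \<open>a\<close> lies in \<open>[0, 2t]\<close>.\<close>

definition pos_cone :: "'a::unital_cstar_algebra set" where
  "pos_cone = {a. star a = a \<and> (\<exists>t. norm (of_real t - a) \<le> t)}"

section \<open>Square roots by the binomial series\<close>

text \<open>The binomial series of \<open>(1 - x)\<close> to the power \<open>1/2\<close> converges absolutely also for \<open>norm x = 1\<close>, since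
  its partial sums at \<open>1\<close> are explicit.\<close>

lemma half_gbinomial_sign:
  assumes "n > 0"
  shows "(- 1) ^ n * ((1/2::real) gchoose n) \<le> 0"
proof -
  obtain m where n: "n = Suc m" using assms by (cases n) auto
  have "(- 1) ^ n * ((1/2::real) gchoose n) = (1/2) / real n * ((-1) ^ n * ((1/2 - 1) gchoose m))"
    unfolding n using gbinomial_rec[of "1/2 - 1 :: real" m] by simp
  also have "\<dots> = - ((1/2) / real n * pochhammer (1/2) m / fact m)"
    unfolding n by (simp add: gbinomial_pochhammer)
  also have "\<dots> \<le> 0"
    by (simp add: pochhammer_nonneg)
  finally show ?thesis .
qed

lemma half_gbinomial_sum_le:
  "(\<Sum>k<n. \<bar>(1/2::real) gchoose (Suc k)\<bar>) \<le> 1"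
proof -
  have "\<bar>(1/2::real) gchoose (Suc k)\<bar> = - ((1/2 gchoose (Suc k)) * (-1) ^ Suc k)" for k
    using half_gbinomial_sign[of "Suc k"] by (cases "even k") auto
  \<comment> \<open>All terms after the zeroth have the same sign, so their absolute values add up
    to 1 minus a partial sum, and the closed form of that partial sum is nonnegative.\<close>
  then have "(\<Sum>k<n. \<bar>(1/2::real) gchoose (Suc k)\<bar>)
      = 1 - (\<Sum>k\<le>n. (1/2 gchoose k) * (-1) ^ k)"
    by (simp add: sum.atMost_shift sum_negf)
  also have "(\<Sum>k\<le>n. (1/2 gchoose k) * (-1) ^ k :: real) = pochhammer (1/2) n / fact n"
    unfolding gbinomial_sum_lower_neg by (simp add: gbinomial_pochhammer)
  finally show ?thesis by (simp add: pochhammer_nonneg)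
qed

lemma half_gbinomial_summable: "summable (\<lambda>k. \<bar>(1/2::real) gchoose k\<bar>)"
proof -
  have "summable (\<lambda>k. \<bar>(1/2::real) gchoose Suc k\<bar>)"
    by (rule summableI_nonneg_bounded[where x = 1]) (auto intro: half_gbinomial_sum_le)
  then show ?thesis by (rule iffD1[OF summable_Suc_iff])
qed

text \<open>The root is the binomial series in \<open>- x\<close>, squared by the Cauchy product and
  Vandermonde's identity. The bound on \<open>1 - s\<close> puts a self-adjoint \<open>s\<close>
  into \<open>pos_cone\<close> with \<open>t = 1\<close>; the commutation clause replaces functional
  calculus later on.\<close>

lemma sqrt_one_minus:
  fixes x :: "'a::unital_cstar_algebra"
  assumes x: "norm x \<le> 1"
  obtains s where "s * s = 1 - x" "norm (1 - s) \<le> 1" "star x = x \<Longrightarrow> star s = s"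
    "\<And>y. x * y = y * x \<Longrightarrow> s * y = y * s"
proof -
  define f where "f = (\<lambda>k. ((1/2::real) gchoose k) *\<^sub>R (- x) ^ k)"
  have nf: "norm (f k) \<le> \<bar>(1/2::real) gchoose k\<bar>" for k
    using norm_power_ineq[of "- x" k] power_le_one[of "norm x" k] x
    by (auto simp: f_def intro!: mult_left_le)
  have sn: "summable (\<lambda>k. norm (f k))"
    by (rule summable_comparison_test'[OF half_gbinomial_summable]) (use nf in auto)
  then have sf: "summable f" by (rule summable_norm_cancel)
  define s where "s = suminf f"
  have "(\<Sum>i\<le>k. f i * f (k - i)) = ((1::real) gchoose k) *\<^sub>R (- x) ^ k" for k
  proof -
    have "(\<Sum>i\<le>k. f i * f (k - i))
        = (\<Sum>i\<le>k. (((1/2::real) gchoose i) * (1/2 gchoose (k - i))) *\<^sub>R (- x) ^ k)"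
      by (intro sum.cong) (auto simp: f_def mult.commute simp flip: power_add)
    also have "\<dots> = ((1/2 + 1/2 :: real) gchoose k) *\<^sub>R (- x) ^ k"
      unfolding scaleR_sum_left[symmetric] gbinomial_Vandermonde[folded atMost_atLeast0] ..
    finally show ?thesis by simp
  qed
  then have "(\<lambda>k. ((1::real) gchoose k) *\<^sub>R (- x) ^ k) sums (s * s)"
    using Cauchy_product_sums[OF sn sn] by (simp add: s_def)
  \<comment> \<open>The series with exponent 1 terminates after its linear term.\<close>
  moreover have "(\<lambda>k. ((1::real) gchoose k) *\<^sub>R (- x) ^ k) sums
      (\<Sum>k\<in>{0,1}. ((1::real) gchoose k) *\<^sub>R (- x) ^ k)"
  proof (rule sums_finite)
    fix k :: nat assume "k \<notin> {0, 1}"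
    then have "(1::real) gchoose k = 0"
      using binomial_gbinomial[of 1 k, where 'a = real] by (simp add: binomial_eq_0)
    then show "((1::real) gchoose k) *\<^sub>R (- x) ^ k = 0" by simp
  qed simp
  ultimately have "s * s = (\<Sum>k\<in>{0,1}. ((1::real) gchoose k) *\<^sub>R (- x) ^ k)"
    using sums_unique2 by blast
  then have 1: "s * s = 1 - x" by simp
  have "f sums s" using sf by (simp add: s_def summable_sums)
  \<comment> \<open>The zeroth term is 1, and the remaining coefficients have absolute sum at most
    1.\<close>
  then have s1: "(\<lambda>k. f (Suc k)) sums (s - 1)"
    by (subst sums_Suc_iff) (simp add: f_def)
  have "norm (s - 1) \<le> 1"
  proof (rule Lim_norm_ubound[OF _ s1[unfolded sums_def]])
    show "\<forall>\<^sub>F n in sequentially. norm (\<Sum>k<n. f (Suc k)) \<le> 1"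
    proof (rule always_eventually, rule allI)
      fix n
      have "norm (\<Sum>k<n. f (Suc k)) \<le> (\<Sum>k<n. \<bar>(1/2::real) gchoose (Suc k)\<bar>)"
        by (rule sum_norm_le) (rule nf)
      then show "norm (\<Sum>k<n. f (Suc k)) \<le> 1"
        using half_gbinomial_sum_le[of n] by linarith
    qed
  qed simp
  then have 2: "norm (1 - s) \<le> 1" by (simp add: norm_minus_commute)
  have 3: "star s = s" if "star x = x"
  proof -
    have "star s = (\<Sum>k. star (f k))"
      unfolding s_def by (rule bounded_linear.suminf[OF bounded_linear_star sf])
    also have "\<dots> = s"
      by (simp add: s_def f_def star_scaleR star_power star_minus that)
    finally show ?thesis .
  qed
  have 4: "s * y = y * s" if "x * y = y * x" for y
  proof -
    have "f k * y = y * f k" for k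
    proof -
      have "(- x) * y = y * (- x)" using that by simp
      then have "(- x) ^ k * y = y * (- x) ^ k" by (rule power_commuting_commutes)
      then show ?thesis by (simp add: f_def)
    qed
    then show ?thesis
      using suminf_mult2[OF sf, of y] suminf_mult[OF sf, of y] by (simp add: s_def)
  qed
  show ?thesis by (rule that[OF 1 2 3 4])
qed


section \<open>Closure properties, roots and norm monotonicity of the cone\<close>

lemma cone_selfadj: "a \<in> pos_cone \<Longrightarrow> star a = a"
  by (simp add: pos_cone_def)

lemma cone_of_real: "r \<ge> 0 \<Longrightarrow> of_real r \<in> pos_cone"
  by (auto simp: pos_cone_def intro!: exI[of _ r])

lemma cone_zero [simp]: "0 \<in> pos_cone"
  using cone_of_real[of 0] by simp

lemma cone_add:
  assumes "a \<in> pos_cone" "b \<in> pos_cone"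
  shows "a + b \<in> pos_cone"
proof -
  obtain s t where st: "norm (of_real s - a) \<le> s" "norm (of_real t - b) \<le> t"
    using assms by (auto simp: pos_cone_def)
  have "norm (of_real (s + t) - (a + b)) = norm ((of_real s - a) + (of_real t - b))"
    by (simp add: algebra_simps)
  also have "\<dots> \<le> s + t"
    using st norm_triangle_ineq[of "of_real s - a" "of_real t - b"] by linarith
  finally show ?thesis
    using assms unfolding pos_cone_def mem_Collect_eq star_add by metis
qed

lemma cone_sum: "(\<And>i. i \<in> I \<Longrightarrow> f i \<in> pos_cone) \<Longrightarrow> sum f I \<in> pos_cone"
  by (induction I rule: infinite_finite_induct) (auto intro: cone_add)

lemma cone_scaleR:
  assumes "a \<in> pos_cone" "r \<ge> 0"
  shows "r *\<^sub>R a \<in> pos_cone"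
proof -
  obtain t where t: "norm (of_real t - a) \<le> t"
    using assms by (auto simp: pos_cone_def)
  have "norm (of_real (r * t) - r *\<^sub>R a) = r * norm (of_real t - a)"
    using assms(2) norm_scaleR[of r "of_real t - a"] by (simp add: of_real_def scaleR_diff_right)
  then have "norm (of_real (r * t) - r *\<^sub>R a) \<le> r * t"
    using t assms(2) by (simp add: mult_left_mono)
  then show ?thesis
    using assms(1) unfolding pos_cone_def mem_Collect_eq star_scaleR by metis
qed

text \<open>If \<open>norm (of_real t - a) \<le> t\<close> with \<open>t > 0\<close>, then
  \<open>1 - a / t\<close> is a self-adjoint contraction, so \<open>a / t\<close> has a root by
  \<open>sqrt_one_minus\<close>; it is rescaled by \<open>sqrt t\<close>.\<close>

lemma cone_sqrt:
  assumes a: "a \<in> pos_cone"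
  obtains s where "s \<in> pos_cone" "s * s = a" "\<And>y. a * y = y * a \<Longrightarrow> s * y = y * s"
proof -
  obtain t where t: "norm (of_real t - a) \<le> t"
    using a by (auto simp: pos_cone_def)
  then have t0: "t \<ge> 0" using norm_ge_zero order_trans by blast
  show ?thesis
  proof (cases "t = 0")
    case True
    then have "a = 0" using t by simp
    then show ?thesis using that[of 0] by simp
  next
    case False
    define x where "x = 1 - (1 / t) *\<^sub>R a"
    have "x = (1 / t) *\<^sub>R (of_real t - a)"
      using False by (simp add: x_def of_real_def scaleR_diff_right)
    then have "norm x \<le> 1" using t t0 False by (simp add: divide_le_eq)
    moreover have "star x = x"
      using a by (simp add: x_def star_diff star_scaleR cone_selfadj)
    ultimately obtain s where s: "s * s = 1 - x" "norm (1 - s) \<le> 1" "star s = s"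
      "\<And>y. x * y = y * x \<Longrightarrow> s * y = y * s"
      using sqrt_one_minus by metis
    show ?thesis
    proof
      have "s \<in> pos_cone" using s(2,3) by (auto simp: pos_cone_def intro!: exI[of _ 1])
      then show "sqrt t *\<^sub>R s \<in> pos_cone" using t0 by (simp add: cone_scaleR)
      show "(sqrt t *\<^sub>R s) * (sqrt t *\<^sub>R s) = a"
        using t0 False by (simp add: s(1) x_def)
      show "(sqrt t *\<^sub>R s) * y = y * (sqrt t *\<^sub>R s)" if "a * y = y * a" for y
        using s(4)[of y] that by (simp add: x_def algebra_simps)
    qed
  qed
qed

text \<open>The difference \<open>of_real r - a * a\<close> is again a square \<open>b * b\<close>,
  with \<open>b\<close> self-adjoint and commuting with \<open>a\<close>, so
  \<open>norm_le_of_commuting_squares\<close> applies with the roles exchanged.\<close>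

lemma selfadj_square_norm_le:
  fixes a :: "'a::unital_cstar_algebra"
  assumes a: "star a = a" and r: "(norm a)\<^sup>2 \<le> r"
  shows "norm (of_real r - a * a) \<le> r"
proof (cases "r = 0")
  case True
  then show ?thesis using r by simp
next
  case False
  with r have r0: "r > 0" using zero_le_power2[of "norm a"] by linarith
  have "norm ((1 / r) *\<^sub>R (a * a)) \<le> 1"
    using r r0 by (simp add: norm_selfadj_power2 a divide_le_eq)
  moreover have "star ((1 / r) *\<^sub>R (a * a)) = (1 / r) *\<^sub>R (a * a)"
    by (simp add: star_scaleR star_mult a)
  ultimately obtain s where s: "s * s = 1 - (1 / r) *\<^sub>R (a * a)" "star s = s"
    "\<And>y. ((1 / r) *\<^sub>R (a * a)) * y = y * ((1 / r) *\<^sub>R (a * a)) \<Longrightarrow> s * y = y * s"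
    using sqrt_one_minus by metis
  define b where "b = sqrt r *\<^sub>R s"
  have b: "b * b = of_real r - a * a"
    using r0 by (simp add: b_def s(1) scaleR_diff_right of_real_def)
  have "s * a = a * s" by (rule s(3)) (simp add: mult.assoc)
  then have "norm (b * b) \<le> r"
    using r0 by (intro norm_le_of_commuting_squares[of _ a])
      (simp_all add: b a, simp_all add: b_def star_scaleR s(2))
  then show ?thesis by (simp add: b)
qed

lemma selfadj_square_cone: "star a = a \<Longrightarrow> a * a \<in> pos_cone"
  using selfadj_square_norm_le[of a "(norm a)\<^sup>2"]
  unfolding pos_cone_def mem_Collect_eq star_mult by (metis order_refl)

text \<open>Since \<open>a\<close> is the square of a self-adjoint element, every bound of its norm
  can serve as the existential \<open>t\<close> of \<open>pos_cone\<close>.\<close>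

lemma cone_norm_le:
  assumes "a \<in> pos_cone" "norm a \<le> r"
  shows "norm (of_real r - a) \<le> r"
proof -
  obtain s where s: "s \<in> pos_cone" "s * s = a"
    using cone_sqrt[OF assms(1)] by blast
  show ?thesis
    using selfadj_square_norm_le[of s r] norm_selfadj_power2[of s] assms(2) s
    by (simp add: cone_selfadj)
qed

lemma selfadj_le_norm: "star a = a \<Longrightarrow> norm a \<le> r \<Longrightarrow> of_real r - a \<in> pos_cone"
  by (auto simp: pos_cone_def star_diff intro!: exI[of _ r])

text \<open>For \<open>r = norm q\<close> both \<open>p\<close> and \<open>of_real r - p\<close> are
  positive. Their roots \<open>c\<close> and \<open>b\<close> commute and satisfy
  \<open>b * b + c * c = of_real r\<close>, which bounds \<open>c * c = p\<close>.\<close>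

lemma cone_norm_mono:
  assumes p: "p \<in> pos_cone" and qp: "q - p \<in> pos_cone"
  shows "norm p \<le> norm q"
proof -
  define r where "r = norm q"
  have "q \<in> pos_cone" using cone_add[OF p qp] by simp
  then have "of_real r - q \<in> pos_cone"
    by (intro selfadj_le_norm) (simp_all add: cone_selfadj r_def)
  from cone_add[OF this qp] have "of_real r - p \<in> pos_cone" by simp
  then obtain b where b: "b \<in> pos_cone" "b * b = of_real r - p"
    "\<And>y. (of_real r - p) * y = y * (of_real r - p) \<Longrightarrow> b * y = y * b"
    using cone_sqrt by blast
  obtain c where c: "c \<in> pos_cone" "c * c = p" "\<And>y. p * y = y * p \<Longrightarrow> c * y = y * c"
    using cone_sqrt[OF p] by metis
  have "of_real r * c = c * of_real r" by (simp add: of_real_def)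
  then have "b * c = c * b"
    by (intro b(3)) (simp add: algebra_simps flip: c(2))
  then have "norm (c * c) \<le> r"
    by (intro norm_le_of_commuting_squares[of _ b])
      (simp_all add: b(1,2) c(1,2) cone_selfadj r_def)
  then show ?thesis by (simp add: c(2) r_def)
qed

lemma cone_antisym: "a \<in> pos_cone \<Longrightarrow> - a \<in> pos_cone \<Longrightarrow> a = 0"
  using cone_norm_mono[of a 0] by simp

text \<open>By \<open>cone_norm_le\<close> the constant \<open>t\<close> may be chosen as
  \<open>norm (f n)\<close>, which converges, so the defining inequality survives the limit.\<close>

lemma cone_closed:
  assumes f: "\<And>n. f n \<in> pos_cone" and l: "f \<longlonglongrightarrow> a"
  shows "a \<in> pos_cone"
proof -
  have "(\<lambda>n. star (f n)) \<longlonglongrightarrow> star a"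
    by (rule bounded_linear.tendsto[OF bounded_linear_star l])
  then have "f \<longlonglongrightarrow> star a" using f by (simp add: cone_selfadj)
  then have 1: "star a = a" using l LIMSEQ_unique by blast
  have "(\<lambda>n. norm (of_real (norm (f n)) - f n)) \<longlonglongrightarrow> norm (of_real (norm a) - a)"
    by (intro tendsto_intros l)
  moreover have "(\<lambda>n. norm (f n)) \<longlonglongrightarrow> norm a" by (intro tendsto_intros l)
  ultimately have "norm (of_real (norm a) - a) \<le> norm a"
    by (rule LIMSEQ_le) (use f in \<open>auto intro!: cone_norm_le\<close>)
  with 1 show ?thesis by (auto simp: pos_cone_def)
qed

lemma cone_suminf:
  assumes "\<And>n. f n \<in> pos_cone" "summable f"
  shows "suminf f \<in> pos_cone"
  using assms by (intro cone_closed[OF _ summable_LIMSEQ]) (auto intro: cone_sum)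

section \<open>Elements \<open>star b * b\<close> belong to the cone\<close>

text \<open>The powers of \<open>t + c c\<^sup>*\<close> are controlled by those of \<open>t + c\<^sup>* c\<close> up to a linear factor, which
  disappears in the limit of \<open>2\<^sup>n\<close>-th roots.\<close>

lemma neg_cone_swap:
  fixes c :: "'a::unital_cstar_algebra"
  assumes "- (star c * c) \<in> pos_cone"
  shows "- (c * star c) \<in> pos_cone"
proof -
  obtain t where t: "norm (of_real t + star c * c) \<le> t"
    using assms by (auto simp: pos_cone_def)
  then have t0: "t \<ge> 0" using norm_ge_zero order_trans by blast
  define v where "v = norm (of_real t + c * star c)"
  have "v \<le> t"
  proof (cases "t = 0")
    case True
    then have "star c * c = 0" using t by simp
    then have "c = 0" using cstar_identity[of c] by simp
    then show ?thesis using t0 by (simp add: v_def)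
  next
    case False
    \<comment> \<open>Since
      \<open>(of_real t + c * star c) * c = c * (of_real t + star c * c)\<close> and the last factor
      has norm at most \<open>t\<close>, each power adds only one more multiple of
      \<open>t ^ n\<close> to the bound on \<open>q\<close>.\<close>
    have ex: "\<exists>q. (of_real t + c * star c) ^ n = of_real (t ^ n) - c * q * star c
        \<and> norm q * t \<le> real n * t ^ n" for n
    proof (induction n)
      case (Suc n)
      then obtain q where q: "(of_real t + c * star c) ^ n = of_real (t ^ n) - c * q * star c"
        "norm q * t \<le> real n * t ^ n" by blast
      define q' where "q' = (of_real t + star c * c) * q - of_real (t ^ n)"
      have "(of_real t + c * star c) ^ Suc n
          = (of_real t + c * star c) * (of_real (t ^ n) - c * q * star c)"
        by (simp only: power_Suc q(1))
      also have "\<dots> = of_real (t ^ Suc n) - c * q' * star c"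
        by (simp add: q'_def algebra_simps of_real_def)
      finally have "(of_real t + c * star c) ^ Suc n = of_real (t ^ Suc n) - c * q' * star c" .
      moreover have "norm q' * t \<le> real (Suc n) * t ^ Suc n"
      proof -
        have "norm q' \<le> norm ((of_real t + star c * c) * q) + t ^ n"
          using norm_triangle_ineq4[of "(of_real t + star c * c) * q" "of_real (t ^ n)"] t0
          unfolding q'_def by (simp del: of_real_power)
        also have "\<dots> \<le> t * norm q + t ^ n"
          using norm_mult_ineq[of "of_real t + star c * c" q] t
          by (smt (verit) mult_right_mono norm_ge_zero)
        finally have "norm q' * t \<le> (t * norm q + t ^ n) * t"
          using t0 by (rule mult_right_mono)
        also have "\<dots> \<le> real (Suc n) * t ^ Suc n"
          using mult_left_mono[OF q(2) t0] by (simp add: algebra_simps)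
        finally show ?thesis .
      qed
      ultimately show ?case by blast
    qed (auto intro!: exI[of _ 0])
    define K where "K = (norm c)\<^sup>2 / t"
    have K0: "K \<ge> 0" using t0 by (simp add: K_def)
    define w where "w = v / t"
    have bound: "w ^ (2 ^ m) \<le> 1 + K * 2 ^ m" for m
    proof -
      define N where "N = (2::nat) ^ m"
      obtain q where q: "(of_real t + c * star c) ^ N = of_real (t ^ N) - c * q * star c"
        "norm q * t \<le> real N * t ^ N" using ex by blast
      have "v ^ N = norm ((of_real t + c * star c) ^ N)"
        unfolding v_def N_def
        by (rule norm_selfadj_power_two_power[symmetric]) (simp add: star_add star_mult star_star)
      also have "\<dots> \<le> t ^ N + norm (c * q * star c)"
        unfolding q using norm_triangle_ineq4[of "of_real (t ^ N)" "c * q * star c"] t0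
        by (simp del: of_real_power)
      also have "norm (c * q * star c) \<le> norm c * norm q * norm (star c)"
        by (rule order_trans[OF norm_mult_ineq]) (intro mult_right_mono norm_mult_ineq norm_ge_zero)
      also have "\<dots> = K * (norm q * t)"
        using False by (simp add: K_def power2_eq_square)
      also have "\<dots> \<le> K * (real N * t ^ N)"
        using q(2) K0 by (rule mult_left_mono)
      finally have "v ^ N \<le> t ^ N * (1 + K * N)"
        by (simp add: algebra_simps)
      then show ?thesis
        using t0 False by (simp add: w_def power_divide divide_le_eq N_def mult.commute)
    qed
    have "w \<le> 1"
    proof (rule ccontr)
      assume "\<not> w \<le> 1"
      then obtain d where d: "w = 1 + d" "d > 0"
        by (metis add.commute diff_add_cancel diff_gt_0_iff_gt not_le)
      \<comment> \<open>With \<open>M = 2 ^ m\<close>, Bernoulli's inequality, squared, makes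
        \<open>w ^ (2 ^ Suc m)\<close> at least quadratic in \<open>M\<close>, while
        \<open>bound\<close> is linear in \<open>M\<close>; this threshold makes the two
        collide.\<close>
      obtain m :: nat where m: "(1 + 2 * K) / d\<^sup>2 < real m" using reals_Archimedean2 by blast
      define M where "M = (2::real) ^ m"
      have M: "M \<ge> 1" "(1 + 2 * K) / d\<^sup>2 < M"
        using m of_nat_less_two_power[of m, where 'a = real] by (auto simp: M_def intro: less_trans)
      have "M * d \<le> 1 + real (2 ^ m) * d" by (simp add: M_def)
      also have "\<dots> \<le> w ^ (2 ^ m)"
        unfolding d using d(2) by (intro Bernoulli_inequality) simp
      finally have "(M * d)\<^sup>2 \<le> (w ^ (2 ^ m))\<^sup>2"
        using M d by (intro power_mono) auto
      also have "\<dots> = w ^ (2 ^ Suc m)" by (simp add: power_even_eq)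
      also have "\<dots> \<le> 1 + K * (2 * M)" using bound[of "Suc m"] by (simp add: M_def)
      also have "\<dots> \<le> (1 + 2 * K) * M" using M by (simp add: algebra_simps)
      finally have "M * (M * d\<^sup>2) \<le> M * (1 + 2 * K)"
        by (simp add: power2_eq_square algebra_simps)
      then have "M * d\<^sup>2 \<le> 1 + 2 * K" using M by simp
      then show False using M d by (simp add: divide_less_eq)
    qed
    then show ?thesis using t0 False by (simp add: w_def divide_le_eq)
  qed
  then show ?thesis
    by (auto simp: pos_cone_def v_def star_minus star_mult star_star intro!: exI[of _ t])
qed

text \<open>Up to sign, \<open>p\<close> and \<open>q\<close> are twice the real and imaginary parts
  of \<open>c\<close>, so \<open>p * p + q * q\<close> is twice
  \<open>star c * c + c * star c\<close>. Together with \<open>neg_cone_swap\<close> this makes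
  \<open>star c * c\<close> positive as well as negative.\<close>

lemma neg_star_mult_cone:
  fixes c :: "'a::unital_cstar_algebra"
  assumes "- (star c * c) \<in> pos_cone"
  shows "c = 0"
proof -
  define p q where "p = c + star c" and "q = \<i> *\<^sub>C (c - star c)"
  have sp: "star p = p" by (simp add: p_def star_add star_star add.commute)
  have sq: "star q = q"
    by (simp add: q_def star_scaleC star_diff star_star scaleC_minus_left scaleC_diff_right)
  have "q * q = - ((c - star c) * (c - star c))"
    using scaleC_of_real[of "-1" "(c - star c) * (c - star c)"]
    by (simp add: q_def scaleC_mult_left scaleC_mult_right scaleC_scaleC)
  then have "p * p + q * q + 2 *\<^sub>R (- (c * star c)) = 2 *\<^sub>R (star c * c)"
    by (simp add: p_def algebra_simps scaleR_2)
  moreover have "p * p + q * q + 2 *\<^sub>R (- (c * star c)) \<in> pos_cone"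
    by (intro cone_add selfadj_square_cone sp sq cone_scaleR neg_cone_swap assms) simp
  ultimately have "2 *\<^sub>R (star c * c) \<in> pos_cone" by simp
  from cone_scaleR[OF this, of "1/2"] have "star c * c \<in> pos_cone" by simp
  then have "star c * c = 0"
    using assms by (intro cone_antisym) simp_all
  then show ?thesis using cstar_identity[of c] by simp
qed

text \<open>With \<open>h = b\<^sup>* b\<close> and \<open>d = |h| - h\<close>, twice the negative part of \<open>h\<close>, the product
  \<open>d h d = (b d)\<^sup>* (b d)\<close> is minus a square, so \<open>b d = 0\<close>.\<close>

lemma star_mult_cone: "star b * b \<in> pos_cone" for b :: "'a::unital_cstar_algebra"
proof -
  define h where "h = star b * b"
  have sh: "star h = h" by (simp add: h_def star_mult star_star)
  obtain m where m: "m \<in> pos_cone" "m * m = h * h"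
    "\<And>y. (h * h) * y = y * (h * h) \<Longrightarrow> m * y = y * m"
    using cone_sqrt[OF selfadj_square_cone[OF sh]] by metis
  \<comment> \<open>\<open>m\<close> is the absolute value of \<open>h\<close>; its root
    \<open>g\<close> exhibits \<open>d * m * d\<close> as the square of the self-adjoint element
    \<open>g * d\<close>.\<close>
  obtain g where g: "g \<in> pos_cone" "g * g = m" "\<And>y. m * y = y * m \<Longrightarrow> g * y = y * g"
    using cone_sqrt[OF m(1)] by metis
  have mh: "m * h = h * m" by (rule m(3)) (simp add: mult.assoc)
  have gh: "g * h = h * g" by (rule g(3)) (rule mh)
  have gm: "g * m = m * g" by (rule g(3)) simp
  define d where "d = m - h"
  have sd: "star d = d" by (simp add: d_def star_diff sh cone_selfadj m)
  have gd: "g * d = d * g" by (simp add: d_def algebra_simps gh gm)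
  have hd: "h * d = - (m * d)" by (simp add: d_def algebra_simps mh m(2))
  have "(g * d) * (g * d) = d * (g * g) * d" by (simp add: gd mult.assoc)
  also have "\<dots> = d * m * d" by (simp add: g)
  also have "\<dots> = - (star (b * d) * (b * d))"
    using hd by (simp add: star_mult sd mult.assoc flip: h_def)
       (simp add: h_def mult.assoc)
  finally have gdd: "(g * d) * (g * d) = - (star (b * d) * (b * d))" .
  have sgd: "star (g * d) = g * d" by (simp add: star_mult sd cone_selfadj g gd)
  have "- (star (b * d) * (b * d)) \<in> pos_cone"
    using selfadj_square_cone[OF sgd] gdd by simp
  then have "b * d = 0" by (rule neg_star_mult_cone)
  then have "(g * d) * (g * d) = 0" using gdd by simp
  then have "g * d = 0" using norm_selfadj_power2[OF sgd] by simp
  then have "m * d = 0" by (metis g(2) mult.assoc mult_zero_right)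
  then have "d * d = 0" using hd by (simp add: d_def left_diff_distrib)
  then have "d = 0" using norm_selfadj_power2[OF sd] by simp
  then show ?thesis using m by (simp add: d_def h_def)
qed

lemma positive_elem_iff_cone: "positive_elem a \<longleftrightarrow> a \<in> pos_cone"
  unfolding positive_elem_def using star_mult_cone cone_sqrt cone_selfadj by metis

lemma cstar_le_iff_cone: "a \<sqsubseteq> b \<longleftrightarrow> b - a \<in> pos_cone"
  by (simp add: cstar_le_def positive_elem_iff_cone)

lemma mult_star_cone: "b * star b \<in> pos_cone"
  using star_mult_cone[of "star b"] by (simp add: star_star)

lemma cone_conj:
  assumes "a \<in> pos_cone"
  shows "c * a * star c \<in> pos_cone"
proof -
  obtain s where "s \<in> pos_cone" "s * s = a" using cone_sqrt[OF assms] by metis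
  then have "c * a * star c = (c * s) * star (c * s)"
    by (simp add: star_mult cone_selfadj mult.assoc flip: \<open>s * s = a\<close>)
  then show ?thesis by (simp only: mult_star_cone)
qed

lemma norm_cone_sum_mono:
  assumes "\<And>i. f i \<in> pos_cone" "finite J" "I \<subseteq> J"
  shows "norm (sum f I) \<le> norm (sum f J)"
  using assms by (intro cone_norm_mono cone_sum)
    (auto simp flip: sum_diff intro: cone_sum)

lemma norm_cone_sum_le_suminf:
  assumes "\<And>i. f i \<in> pos_cone" "summable f" "finite I"
  shows "norm (sum f I) \<le> norm (suminf f)"
proof -
  obtain n where n: "I \<subseteq> {..<n}" using finite_nat_iff_bounded assms(3) by blast
  have "suminf f - sum f {..<n} = (\<Sum>i. f (i + n))"
    using suminf_minus_initial_segment[OF assms(2), of n] by simp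
  then have "suminf f - sum f {..<n} \<in> pos_cone"
    using assms by (auto intro!: cone_suminf simp: summable_iff_shift)
  then have "norm (sum f {..<n}) \<le> norm (suminf f)"
    using assms by (intro cone_norm_mono cone_sum)
  then show ?thesis
    using norm_cone_sum_mono[of f "{..<n}" I] assms n by force
qed

section \<open>Norm inequalities and order inequalities\<close>

text \<open>Up to the factor \<open>t + e\<close> the element is \<open>1 - x\<close> with
  \<open>norm x < 1\<close>. In place of a Neumann series, the inverse is the fixed point of the
  contraction sending \<open>w\<close> to \<open>w * x + 1\<close>.\<close>

lemma cone_add_of_real_left_inverse:
  fixes p :: "'a::unital_cstar_algebra"
  assumes "p \<in> pos_cone" "e > 0"
  obtains w where "w * (p + of_real e) = 1"
proof -
  obtain t where t: "norm (of_real t - p) \<le> t"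
    using assms(1) by (auto simp: pos_cone_def)
  then have t0: "t \<ge> 0" using norm_ge_zero order_trans by blast
  define x where "x = (1 / (t + e)) *\<^sub>R (of_real t - p)"
  have x: "norm x < 1" using t t0 assms(2) by (simp add: x_def divide_less_eq)
  have "\<exists>!w. w * x + 1 = w"
  proof (rule banach_fix_type[where c = "norm x"])
    show "\<forall>w z. dist (w * x + 1) (z * x + 1) \<le> norm x * dist w z"
      by (auto simp: dist_norm mult.commute[of "norm x"] simp flip: left_diff_distrib
          intro: norm_mult_ineq)
  qed (use x in auto)
  then obtain w where "w * x + 1 = w" by blast
  then have "w * (1 - x) = 1" by (simp add: algebra_simps)
  moreover have "p + of_real e = (t + e) *\<^sub>R (1 - x)"
    using t0 assms(2) by (simp add: x_def scaleR_diff_right of_real_def scaleR_add_left)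
  ultimately have "((1 / (t + e)) *\<^sub>R w) * (p + of_real e) = 1"
    using t0 assms(2) by simp
  then show ?thesis by (rule that)
qed

text \<open>The hypothesis is applied to \<open>a = (p + e)\<close> to the power \<open>-1/2\<close>, for which \<open>a p a\<^sup>*\<close> is a
  contraction.\<close>

lemma cone_le_of_norm_conj_le:
  fixes p q :: "'a::unital_cstar_algebra"
  assumes p: "p \<in> pos_cone" and q: "q \<in> pos_cone"
    and le: "\<And>a. norm (a * q * star a) \<le> K * norm (a * p * star a)" and K: "K \<ge> 0"
  shows "K *\<^sub>R p - q \<in> pos_cone"
proof -
  have approx: "K *\<^sub>R (p + of_real e) - q \<in> pos_cone" if e: "e > 0" for e
  proof -
    obtain r where r: "r \<in> pos_cone" "r * r = p + of_real e"
      using cone_sqrt[OF cone_add[OF p cone_of_real[of e]]] e by (metis less_imp_le)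
    obtain w where w: "w * (p + of_real e) = 1"
      using cone_add_of_real_left_inverse[OF p e] by metis
    \<comment> \<open>\<open>h\<close> is the inverse root of \<open>p + of_real e\<close>. A priori
      it is only a left inverse of \<open>r\<close>; as \<open>r\<close> is self-adjoint,
      \<open>star h\<close> is a right inverse, and the two coincide.\<close>
    define h where "h = w * r"
    have hr: "h * r = 1" using w by (simp add: h_def mult.assoc r)
    then have rsh: "r * star h = 1" using star_mult[of h r] r by (simp add: cone_selfadj)
    have sh: "star h = h" using hr rsh by (metis mult.assoc mult.left_neutral mult.right_neutral)
    have "h * (p + of_real e) * star h = 1"
      unfolding r(2)[symmetric] using hr rsh by (metis mult.assoc mult.left_neutral)
    then have "1 - h * p * star h = e *\<^sub>R (h * star h)"
      by (simp add: algebra_simps of_real_def)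
    then have "1 - h * p * star h \<in> pos_cone"
      using e by (simp add: cone_scaleR mult_star_cone)
    then have "norm (h * p * star h) \<le> 1"
      using cone_norm_mono[OF cone_conj[OF p, of h], of 1] by simp
    then have "norm (h * q * star h) \<le> K"
      using le[of h] K mult_left_le by (metis mult.commute order_trans)
    then have "of_real K - h * q * star h \<in> pos_cone"
      by (intro selfadj_le_norm cone_selfadj cone_conj q)
    \<comment> \<open>Conjugation by \<open>r\<close> undoes the conjugation by its inverse
      \<open>h\<close>.\<close>
    then have "r * (of_real K - h * q * star h) * star r \<in> pos_cone"
      by (rule cone_conj)
    also have "r * (of_real K - h * q * star h) * star r = K *\<^sub>R (r * r) - (r * h) * q * (h * r)"
      using r(1) by (simp add: cone_selfadj sh algebra_simps of_real_def)
    also have "\<dots> = K *\<^sub>R (p + of_real e) - q"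
      using hr rsh sh by (simp add: r)
    finally show ?thesis .
  qed
  have "(\<lambda>n. K *\<^sub>R (p + of_real (inverse (real (Suc n)))) - q) \<longlonglongrightarrow> K *\<^sub>R (p + of_real 0) - q"
    by (intro tendsto_intros LIMSEQ_inverse_real_of_nat)
  then have "(\<lambda>n. K *\<^sub>R (p + of_real (inverse (real (Suc n)))) - q) \<longlonglongrightarrow> K *\<^sub>R p - q"
    by simp
  then show ?thesis by (rule cone_closed[rotated]) (rule approx, simp)
qed

text \<open>Here \<open>p\<close>, \<open>q\<close>, \<open>c\<close> play the roles of
  \<open>ip x x\<close>, \<open>ip y y\<close>, \<open>ip x y\<close> for a semi-inner product, and
  \<open>pos\<close> is positivity at \<open>x - smul a y\<close>. The square is completed by
  \<open>a = c / r\<close> after \<open>q\<close> is bounded by \<open>r\<close>.\<close>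

lemma cauchy_schwarz_cone:
  fixes p q c :: "'a::unital_cstar_algebra"
  assumes pos: "\<And>a. p - c * star a - a * star c + a * q * star a \<in> pos_cone"
    and q: "q \<in> pos_cone" and r: "norm q \<le> r" "r > 0"
  shows "r *\<^sub>R p - c * star c \<in> pos_cone"
proof -
  define a where "a = (1 / r) *\<^sub>R c"
  have "of_real r - q \<in> pos_cone" using q r by (intro selfadj_le_norm cone_selfadj)
  then have "r *\<^sub>R (a * (of_real r - q) * star a) \<in> pos_cone"
    using r by (intro cone_scaleR cone_conj) auto
  moreover have "r *\<^sub>R (p - c * star a - a * star c + a * q * star a) \<in> pos_cone"
    using r pos by (intro cone_scaleR) auto
  ultimately have "r *\<^sub>R (p - c * star a - a * star c + a * q * star a)
      + r *\<^sub>R (a * (of_real r - q) * star a) \<in> pos_cone"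
    by (intro cone_add)
  also have "r *\<^sub>R (p - c * star a - a * star c + a * q * star a)
      + r *\<^sub>R (a * (of_real r - q) * star a) = r *\<^sub>R p - c * star c"
    using r by (simp add: a_def algebra_simps star_scaleR of_real_def)
  finally show ?thesis .
qed

lemma cauchy_schwarz_norm:
  fixes p q c :: "'a::unital_cstar_algebra"
  assumes pos: "\<And>a. p - c * star a - a * star c + a * q * star a \<in> pos_cone"
    and q: "q \<in> pos_cone"
  shows "(norm c)\<^sup>2 \<le> norm p * norm q"
proof -
  \<comment> \<open>A strict bound keeps \<open>r\<close> positive even for \<open>q = 0\<close>;
    afterwards \<open>r\<close> decreases to \<open>norm q\<close>.\<close>
  have *: "(norm c)\<^sup>2 \<le> norm p * r" if "r > norm q" for r
  proof -
    have r: "r > 0" using that norm_ge_zero le_less_trans by blast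
    have "norm (c * star c) \<le> norm (r *\<^sub>R p)"
      using cauchy_schwarz_cone[OF pos q _ r] that by (intro cone_norm_mono mult_star_cone) simp
    then show ?thesis using r by (simp add: norm_mult_star mult.commute)
  qed
  show ?thesis
  proof (cases "p = 0")
    case True
    then show ?thesis using *[of "norm q + 1"] by simp
  next
    case False
    have "(norm c)\<^sup>2 / norm p \<le> norm q"
    proof (rule dense_ge)
      fix r assume "norm q < r"
      from *[OF this] False show "(norm c)\<^sup>2 / norm p \<le> r"
        by (simp add: pos_divide_le_eq mult.commute[of r])
    qed
    then show ?thesis using False by (simp add: pos_divide_le_eq mult.commute[of "norm q"])
  qed
qed

section \<open>Square-summable sequences\<close>

lemma norm_sum_mult_star_le:
  fixes a b :: "nat \<Rightarrow> 'a::unital_cstar_algebra"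
  shows "(norm (\<Sum>i\<in>I. a i * star (b i)))\<^sup>2
    \<le> norm (\<Sum>i\<in>I. a i * star (a i)) * norm (\<Sum>i\<in>I. b i * star (b i))"
proof (rule cauchy_schwarz_norm)
  fix x
  have "(\<Sum>i\<in>I. a i * star (a i)) - (\<Sum>i\<in>I. a i * star (b i)) * star x
      - x * star (\<Sum>i\<in>I. a i * star (b i)) + x * (\<Sum>i\<in>I. b i * star (b i)) * star x
      = (\<Sum>i\<in>I. (a i - x * b i) * star (a i - x * b i))"
    by (simp add: algebra_simps star_diff star_mult star_sum star_star sum_distrib_left
        sum_distrib_right sum.distrib sum_subtractf)
  also have "\<dots> \<in> pos_cone" by (intro cone_sum mult_star_cone)
  finally show "(\<Sum>i\<in>I. a i * star (a i)) - (\<Sum>i\<in>I. a i * star (b i)) * star x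
      - x * star (\<Sum>i\<in>I. a i * star (b i)) + x * (\<Sum>i\<in>I. b i * star (b i)) * star x \<in> pos_cone" .
qed (intro cone_sum mult_star_cone)

lemma l2_summable: "a \<in> l2 \<Longrightarrow> summable (\<lambda>n. a n * star (a n))"
  by (simp add: l2_def)

text \<open>Cauchy-Schwarz on the blocks from \<open>m\<close> to \<open>n\<close> carries the
  Cauchy criterion over from the two diagonal series.\<close>

lemma l2_summable_ip:
  fixes a b :: "nat \<Rightarrow> 'a::unital_cstar_algebra"
  assumes a: "a \<in> l2" and b: "b \<in> l2"
  shows "summable (\<lambda>n. a n * star (b n))"
proof (subst summable_Cauchy, intro allI impI)
  fix e :: real assume e: "e > 0"
  obtain N1 where N1: "\<And>m n. m \<ge> N1 \<Longrightarrow> norm (\<Sum>i=m..<n. a i * star (a i)) < e"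
    using l2_summable[OF a, unfolded summable_Cauchy, rule_format, OF e] by blast
  obtain N2 where N2: "\<And>m n. m \<ge> N2 \<Longrightarrow> norm (\<Sum>i=m..<n. b i * star (b i)) < e"
    using l2_summable[OF b, unfolded summable_Cauchy, rule_format, OF e] by blast
  have "norm (\<Sum>i=m..<n. a i * star (b i)) < e" if "m \<ge> max N1 N2" for m n
  proof -
    have "(norm (\<Sum>i=m..<n. a i * star (b i)))\<^sup>2
        \<le> norm (\<Sum>i=m..<n. a i * star (a i)) * norm (\<Sum>i=m..<n. b i * star (b i))"
      by (rule norm_sum_mult_star_le)
    also have "\<dots> < e * e" using N1[of m n] N2[of m n] that by (intro mult_strict_mono') auto
    finally show ?thesis using e by (simp add: power2_less_imp_less[of _ e] flip: power2_eq_square)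
  qed
  then show "\<exists>N. \<forall>m\<ge>N. \<forall>n. norm (\<Sum>i=m..<n. a i * star (b i)) < e" by blast
qed

lemma l2_ip_sums: "a \<in> l2 \<Longrightarrow> b \<in> l2 \<Longrightarrow> (\<lambda>n. a n * star (b n)) sums l2_ip a b"
  unfolding l2_ip_def by (intro summable_sums l2_summable_ip)

lemma l2_norm_nonneg [simp]: "l2_norm a \<ge> 0"
  by (simp add: l2_norm_def)

lemma l2_norm_power2: "(l2_norm a)\<^sup>2 = norm (l2_ip a a)"
  by (simp add: l2_norm_def)

lemma l2_norm_partial_sum:
  "a \<in> l2 \<Longrightarrow> finite I \<Longrightarrow> norm (\<Sum>i\<in>I. a i * star (a i)) \<le> (l2_norm a)\<^sup>2"
  unfolding l2_norm_power2 l2_ip_def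
  by (intro norm_cone_sum_le_suminf mult_star_cone l2_summable)

lemma l2_cauchy_schwarz:
  assumes "a \<in> l2" "b \<in> l2"
  shows "norm (l2_ip a b) \<le> l2_norm a * l2_norm b"
proof (rule Lim_norm_ubound[OF _ l2_ip_sums[OF assms, unfolded sums_def]])
  show "\<forall>\<^sub>F n in sequentially. norm (\<Sum>i<n. a i * star (b i)) \<le> l2_norm a * l2_norm b"
  proof (rule always_eventually, rule allI)
    fix n
    have "(norm (\<Sum>i<n. a i * star (b i)))\<^sup>2
        \<le> norm (\<Sum>i<n. a i * star (a i)) * norm (\<Sum>i<n. b i * star (b i))"
      by (rule norm_sum_mult_star_le)
    also have "\<dots> \<le> (l2_norm a)\<^sup>2 * (l2_norm b)\<^sup>2"
      by (intro mult_mono l2_norm_partial_sum assms) auto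
    finally show "norm (\<Sum>i<n. a i * star (b i)) \<le> l2_norm a * l2_norm b"
      by (rule power2_le_imp_le[of _ "l2_norm a * l2_norm b", unfolded power_mult_distrib]) simp
  qed
qed simp

lemma l2_add:
  assumes "a \<in> l2" "b \<in> l2"
  shows "(\<lambda>n. a n + b n) \<in> l2"
proof -
  have "summable (\<lambda>n. (a n * star (a n) + a n * star (b n)) + (b n * star (a n) + b n * star (b n)))"
    by (intro summable_add l2_summable_ip assms)
  then show ?thesis by (simp add: l2_def star_add algebra_simps)
qed

lemma l2_mult_left:
  assumes "a \<in> l2"
  shows "(\<lambda>n. x * a n) \<in> l2"
proof -
  have "summable (\<lambda>n. x * (a n * star (a n)) * star x)"
    by (intro summable_mult summable_mult2 l2_summable assms)
  then show ?thesis by (simp add: l2_def star_mult mult.assoc)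
qed

lemma l2_diff: "a \<in> l2 \<Longrightarrow> b \<in> l2 \<Longrightarrow> (\<lambda>n. a n - b n) \<in> l2"
  using l2_add[of a "\<lambda>n. (-1) * b n"] l2_mult_left[of b "-1"] by simp

lemma l2_ip_add_left:
  "a \<in> l2 \<Longrightarrow> b \<in> l2 \<Longrightarrow> c \<in> l2 \<Longrightarrow> l2_ip (\<lambda>n. a n + b n) c = l2_ip a c + l2_ip b c"
  using suminf_add[OF l2_summable_ip[of a c] l2_summable_ip[of b c]]
  by (simp add: l2_ip_def distrib_right)

lemma l2_ip_mult_left:
  "a \<in> l2 \<Longrightarrow> c \<in> l2 \<Longrightarrow> l2_ip (\<lambda>n. x * a n) c = x * l2_ip a c"
  by (simp add: l2_ip_def mult.assoc suminf_mult l2_summable_ip)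

lemma l2_ip_star:
  assumes "a \<in> l2" "b \<in> l2"
  shows "star (l2_ip a b) = l2_ip b a"
  unfolding l2_ip_def
  by (subst bounded_linear.suminf[OF bounded_linear_star])
    (simp_all add: l2_summable_ip assms star_mult star_star)

lemma l2_ip_add_right:
  assumes "a \<in> l2" "b \<in> l2" "c \<in> l2"
  shows "l2_ip c (\<lambda>n. a n + b n) = l2_ip c a + l2_ip c b"
proof -
  have "l2_ip c (\<lambda>n. a n + b n) = star (l2_ip (\<lambda>n. a n + b n) c)"
    by (simp add: l2_ip_star l2_add assms)
  then show ?thesis by (simp add: l2_ip_add_left star_add l2_ip_star assms)
qed

lemma l2_ip_mult_right:
  assumes "a \<in> l2" "c \<in> l2"
  shows "l2_ip c (\<lambda>n. x * a n) = l2_ip c a * star x"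
proof -
  have "l2_ip c (\<lambda>n. x * a n) = star (l2_ip (\<lambda>n. x * a n) c)"
    by (simp add: l2_ip_star l2_mult_left assms)
  then show ?thesis by (simp add: l2_ip_mult_left star_mult l2_ip_star assms)
qed

lemma l2_norm_triangle:
  assumes a: "a \<in> l2" and b: "b \<in> l2"
  shows "l2_norm (\<lambda>n. a n + b n) \<le> l2_norm a + l2_norm b"
proof -
  have "(l2_norm (\<lambda>n. a n + b n))\<^sup>2
      = norm (l2_ip a a + l2_ip a b + (l2_ip b a + l2_ip b b))"
    by (simp add: l2_norm_power2 l2_ip_add_left l2_ip_add_right l2_add a b algebra_simps)
  also have "\<dots> \<le> norm (l2_ip a a) + norm (l2_ip a b) + (norm (l2_ip b a) + norm (l2_ip b b))"
    by (intro norm_triangle_le add_mono norm_triangle_ineq)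
  also have "\<dots> \<le> (l2_norm a)\<^sup>2 + l2_norm a * l2_norm b + (l2_norm b * l2_norm a + (l2_norm b)\<^sup>2)"
    by (intro add_mono l2_cauchy_schwarz a b) (simp_all add: l2_norm_power2)
  also have "\<dots> = (l2_norm a + l2_norm b)\<^sup>2" by (simp add: power2_eq_square algebra_simps)
  finally show ?thesis by (rule power2_le_imp_le) simp
qed

lemma l2_norm_mult_left:
  assumes "a \<in> l2"
  shows "l2_norm (\<lambda>n. x * a n) \<le> norm x * l2_norm a"
proof -
  have "(l2_norm (\<lambda>n. x * a n))\<^sup>2 = norm (x * l2_ip a a * star x)"
    by (simp add: l2_norm_power2 l2_ip_mult_left l2_ip_mult_right l2_mult_left assms
        mult.assoc)
  also have "\<dots> \<le> norm x * norm (l2_ip a a) * norm (star x)"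
    by (rule order_trans[OF norm_mult_ineq]) (intro mult_right_mono norm_mult_ineq norm_ge_zero)
  also have "\<dots> = (norm x * l2_norm a)\<^sup>2"
    by (simp add: power2_eq_square flip: l2_norm_power2)
  finally show ?thesis by (rule power2_le_imp_le) simp
qed

lemma l2_norm_eq_zero:
  assumes "a \<in> l2" "l2_norm a = 0"
  shows "a n = 0"
  using l2_norm_partial_sum[OF assms(1), of "{n}"] assms(2) by (simp add: norm_mult_star)

lemma finite_support_l2:
  assumes "\<And>n. n \<ge> N \<Longrightarrow> a n = 0"
  shows "a \<in> l2"
  unfolding l2_def mem_Collect_eq
  by (rule summable_finite[of "{..<N}"]) (use assms in \<open>auto simp: not_less\<close>)

lemma l2_unit_l2: "l2_unit n \<in> l2"
  by (rule finite_support_l2[of "Suc n"]) (simp add: l2_unit_def)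

lemma l2_ip_unit: "l2_ip (l2_unit n) b = star (b n)"
proof -
  have "l2_ip (l2_unit n) b = (\<Sum>k\<in>{n}. l2_unit n k * star (b k))"
    unfolding l2_ip_def by (rule suminf_finite) (auto simp: l2_unit_def)
  then show ?thesis by (simp add: l2_unit_def)
qed

lemma l2_norm_truncation:
  "(l2_norm (\<lambda>n. if n < N then a n else 0))\<^sup>2 = norm (\<Sum>n<N. a n * star (a n))"
proof -
  have "l2_ip (\<lambda>n. if n < N then a n else 0) (\<lambda>n. if n < N then a n else 0)
      = (\<Sum>n<N. (if n < N then a n else 0) * star (if n < N then a n else 0))"
    unfolding l2_ip_def by (rule suminf_finite) auto
  then show ?thesis by (simp add: l2_norm_power2)
qed

section \<open>Hilbert modules and synthesis operators\<close>

context hilbert_module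
begin

lemma ip_cone: "ip x x \<in> pos_cone"
  using ip_positive by (simp add: positive_elem_iff_cone)

lemma norm_power2: "(norm x)\<^sup>2 = norm (ip x x)"
  by (simp add: norm_eq)

lemma ip_add_right: "ip x (y + z) = ip x y + ip x z"
  using ip_add_left[of y z x] ip_star[of "y + z" x] by (simp add: star_add ip_star)

lemma ip_smul_right: "ip x (smul a y) = ip x y * star a"
  using ip_smul_left[of a y x] ip_star[of "smul a y" x] by (simp add: star_mult ip_star)

lemma smul_zero_right [simp]: "smul a 0 = 0"
  using smul_add_right[of a 0 0] by simp

lemma smul_zero_left [simp]: "smul 0 x = 0"
  using smul_add_left[of 0 0 x] by simp

lemma smul_minus_left: "smul (- a) x = - smul a x"
  using smul_add_left[of "- a" a x] by (simp add: eq_neg_iff_add_eq_0)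

lemma smul_diff_left: "smul (a - b) x = smul a x - smul b x"
  using smul_add_left[of a "- b" x] by (simp add: smul_minus_left)

lemma ip_scaleR_left: "ip (r *\<^sub>R x) y = r *\<^sub>R ip x y"
  by (simp add: scaleR_eq[of r x] ip_smul_left)

lemma ip_minus_left: "ip (- x) y = - ip x y"
  using ip_scaleR_left[of "-1" x y] by simp

lemma ip_diff_left: "ip (x - y) z = ip x z - ip y z"
  using ip_add_left[of x "- y" z] by (simp add: ip_minus_left)

lemma ip_diff_right: "ip x (y - z) = ip x y - ip x z"
  using ip_diff_left[of y z x] by (metis ip_star star_diff)

lemma ip_eqI:
  assumes "\<And>z. ip z x = ip z y"
  shows "x = y"
  using ip_definite[of "x - y"] assms[of "x - y"] by (simp add: ip_diff_right)

lemma ip_eqI_left: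
  assumes "\<And>z. ip x z = ip y z"
  shows "x = y"
  using ip_definite[of "x - y"] assms[of "x - y"] by (simp add: ip_diff_left)

lemma cauchy_schwarz: "norm (ip x y) \<le> norm x * norm y"
proof -
  have "(norm (ip x y))\<^sup>2 \<le> norm (ip x x) * norm (ip y y)"
  proof (rule cauchy_schwarz_norm)
    fix a
    have "ip x x - ip x y * star a - a * star (ip x y) + a * ip y y * star a
        = ip (x - smul a y) (x - smul a y)"
      by (simp add: ip_diff_left ip_diff_right ip_smul_left ip_smul_right ip_star algebra_simps)
    then show "ip x x - ip x y * star a - a * star (ip x y) + a * ip y y * star a \<in> pos_cone"
      by (simp add: ip_cone)
  qed (rule ip_cone)
  also have "\<dots> = (norm x * norm y)\<^sup>2" by (simp add: power_mult_distrib norm_power2)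
  finally show ?thesis by (rule power2_le_imp_le) simp
qed

lemma bounded_linear_ip: "bounded_linear (\<lambda>x. ip x y)"
  by (rule bounded_linear_intro[where K = "norm y"])
    (simp_all add: ip_add_left ip_scaleR_left cauchy_schwarz)

lemma norm_smul: "norm (smul a x) \<le> norm a * norm x"
proof -
  have "(norm (smul a x))\<^sup>2 = norm (a * ip x x * star a)"
    by (simp add: norm_power2 ip_smul_left ip_smul_right mult.assoc)
  also have "\<dots> \<le> norm a * norm (ip x x) * norm (star a)"
    by (rule order_trans[OF norm_mult_ineq]) (intro mult_right_mono norm_mult_ineq norm_ge_zero)
  also have "\<dots> = (norm a * norm x)\<^sup>2"
    by (simp add: power2_eq_square flip: norm_power2)
  finally show ?thesis by (rule power2_le_imp_le) simp
qed

lemma smul_scaleR_right: "smul a (r *\<^sub>R x) = r *\<^sub>R smul a x"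
  by (simp add: scaleR_eq[of r] smul_smul)

lemma bounded_linear_smul: "bounded_linear (smul a)"
  by (rule bounded_linear_intro[where K = "norm a"])
    (simp_all add: smul_add_right smul_scaleR_right norm_smul mult.commute)

lemma bounded_linear_smul_left: "bounded_linear (\<lambda>a. smul a x)"
  by (rule bounded_linear_intro[where K = "norm x"])
    (simp_all add: smul_add_left norm_smul scaleR_eq[of _ "smul _ x"] smul_smul)

text \<open>The upper frame inequality in norm form. It suffices for synthesis to converge on all of
  \<open>l2\<close> and to be the adjoint of the analysis operator.\<close>

definition bessel_bound :: "(nat \<Rightarrow> 'e) \<Rightarrow> real \<Rightarrow> bool" where
  "bessel_bound X K \<longleftrightarrow> K \<ge> 0 \<and> (\<forall>x. analysis_op ip X x \<in> l2) \<and>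
     (\<forall>x. l2_norm (analysis_op ip X x) \<le> K * norm x)"

lemma bessel_boundD:
  assumes "bessel_bound X K"
  shows "K \<ge> 0" "analysis_op ip X x \<in> l2" "l2_norm (analysis_op ip X x) \<le> K * norm x"
  using assms by (simp_all add: bessel_bound_def)

lemma analysis_add: "analysis_op ip X (x + y) = (\<lambda>n. analysis_op ip X x n + analysis_op ip X y n)"
  by (simp add: analysis_op_def ip_add_left)

lemma analysis_smul: "analysis_op ip X (smul a x) = (\<lambda>n. a * analysis_op ip X x n)"
  by (simp add: analysis_op_def ip_smul_left)

text \<open>Pairing the sum \<open>u\<close> with itself gives an \<open>l2\<close>-type pairing of
  \<open>a\<close> with the analysis of \<open>u\<close>. Cauchy-Schwarz and the Bessel bound leave
  a common factor \<open>(norm u)\<^sup>2\<close> to cancel.\<close>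

lemma norm_sum_smul_le:
  assumes X: "bessel_bound X K" and I: "finite I"
  shows "(norm (\<Sum>i\<in>I. smul (a i) (X i)))\<^sup>2 \<le> K\<^sup>2 * norm (\<Sum>i\<in>I. a i * star (a i))"
proof -
  define u where "u = (\<Sum>i\<in>I. smul (a i) (X i))"
  define s where "s = norm (\<Sum>i\<in>I. a i * star (a i))"
  have "ip u u = (\<Sum>i\<in>I. a i * star (analysis_op ip X u i))"
    by (subst u_def) (simp add: linear_sum[OF bounded_linear.linear[OF bounded_linear_ip]]
        ip_smul_left analysis_op_def ip_star)
  then have "((norm u)\<^sup>2)\<^sup>2 = (norm (\<Sum>i\<in>I. a i * star (analysis_op ip X u i)))\<^sup>2"
    by (simp add: norm_power2)
  also have "\<dots> \<le> s * norm (\<Sum>i\<in>I. analysis_op ip X u i * star (analysis_op ip X u i))"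
    unfolding s_def by (rule norm_sum_mult_star_le)
  also have "\<dots> \<le> s * (l2_norm (analysis_op ip X u))\<^sup>2"
    by (intro mult_left_mono l2_norm_partial_sum bessel_boundD[OF X] I) (simp add: s_def)
  also have "\<dots> \<le> s * (K * norm u)\<^sup>2"
    by (intro mult_left_mono power_mono bessel_boundD[OF X] l2_norm_nonneg) (simp add: s_def)
  finally have *: "(norm u)\<^sup>2 * (norm u)\<^sup>2 \<le> (K\<^sup>2 * s) * (norm u)\<^sup>2"
    by (simp add: power2_eq_square algebra_simps)
  show ?thesis
  proof (cases "u = 0")
    case True
    then show ?thesis by (simp flip: u_def)
  next
    case False
    then show ?thesis using mult_right_le_imp_le[OF *] by (simp flip: u_def s_def)
  qed
qed

lemma synthesis_sums:
  assumes X: "bessel_bound X K" and a: "a \<in> l2"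
  shows "(\<lambda>n. smul (a n) (X n)) sums synthesis_op smul X a"
proof -
  have "summable (\<lambda>n. smul (a n) (X n))"
  proof (subst summable_Cauchy, intro allI impI)
    fix e :: real assume e: "e > 0"
    \<comment> \<open>The summand 1 in the denominator covers \<open>K = 0\<close>.\<close>
    define d where "d = e\<^sup>2 / (K\<^sup>2 + 1)"
    have "d > 0" using e by (simp add: d_def add_nonneg_pos)
    then obtain N where N: "\<And>m n. m \<ge> N \<Longrightarrow> norm (\<Sum>i=m..<n. a i * star (a i)) < d"
      using l2_summable[OF a, unfolded summable_Cauchy, rule_format, OF \<open>d > 0\<close>] by blast
    have "norm (\<Sum>i=m..<n. smul (a i) (X i)) < e" if "m \<ge> N" for m n
    proof -
      have "(norm (\<Sum>i=m..<n. smul (a i) (X i)))\<^sup>2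
          \<le> K\<^sup>2 * norm (\<Sum>i=m..<n. a i * star (a i))"
        by (rule norm_sum_smul_le[OF X]) simp
      also have "\<dots> \<le> K\<^sup>2 * d" using N[OF that, of n] by (intro mult_left_mono) auto
      also have "\<dots> < (K\<^sup>2 + 1) * d" using \<open>d > 0\<close> by simp
      also have "\<dots> = e\<^sup>2"
      proof -
        have "K\<^sup>2 + 1 \<noteq> 0" using zero_le_power2[of K] by linarith
        then show ?thesis by (simp add: d_def)
      qed
      finally show ?thesis by (rule power2_less_imp_less) (use e in auto)
    qed
    then show "\<exists>N. \<forall>m\<ge>N. \<forall>n. norm (\<Sum>i=m..<n. smul (a i) (X i)) < e" by blast
  qed
  then show ?thesis unfolding synthesis_op_def by (rule summable_sums)
qed

lemma norm_synthesis_le: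
  assumes X: "bessel_bound X K" and a: "a \<in> l2"
  shows "norm (synthesis_op smul X a) \<le> K * l2_norm a"
proof (rule Lim_norm_ubound[OF _ synthesis_sums[OF assms, unfolded sums_def]])
  show "\<forall>\<^sub>F n in sequentially. norm (\<Sum>i<n. smul (a i) (X i)) \<le> K * l2_norm a"
  proof (rule always_eventually, rule allI)
    fix n
    have "(norm (\<Sum>i<n. smul (a i) (X i)))\<^sup>2 \<le> K\<^sup>2 * norm (\<Sum>i<n. a i * star (a i))"
      by (rule norm_sum_smul_le[OF X]) simp
    also have "\<dots> \<le> K\<^sup>2 * (l2_norm a)\<^sup>2"
      by (intro mult_left_mono l2_norm_partial_sum a) auto
    finally show "norm (\<Sum>i<n. smul (a i) (X i)) \<le> K * l2_norm a"
      by (rule power2_le_imp_le[of _ "K * l2_norm a", unfolded power_mult_distrib])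
         (simp add: bessel_boundD(1)[OF X])
  qed
qed simp

lemma ip_synthesis:
  assumes X: "bessel_bound X K" and a: "a \<in> l2"
  shows "ip (synthesis_op smul X a) x = l2_ip a (analysis_op ip X x)"
proof -
  have "(\<lambda>n. ip (smul (a n) (X n)) x) sums ip (synthesis_op smul X a) x"
    by (rule bounded_linear.sums[OF bounded_linear_ip synthesis_sums[OF assms]])
  then show ?thesis
    by (simp add: ip_smul_left l2_ip_def analysis_op_def ip_star sums_iff)
qed

lemma synthesis_diff:
  assumes X: "bessel_bound X K" and a: "a \<in> l2" and b: "b \<in> l2"
  shows "synthesis_op smul X (\<lambda>n. a n - b n) = synthesis_op smul X a - synthesis_op smul X b"
  using sums_diff[OF synthesis_sums[OF X a] synthesis_sums[OF X b]]
  by (simp add: synthesis_op_def smul_diff_left sums_iff)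

end

section \<open>Standard frames and their duals\<close>

text \<open>Substituting \<open>y = T x\<close> turns boundedness of the inverse into a lower bound
  for \<open>T\<close>, which is the form the frame inequality supplies.\<close>

lemma invertible_op_iff:
  "invertible_op H nH K nK T \<longleftrightarrow> bij_betw T H K \<and> (\<exists>B. \<forall>x\<in>H. nH x \<le> B * nK (T x))"
proof -
  have "(\<forall>y\<in>K. nH (the_inv_into H T y) \<le> B * nK y) \<longleftrightarrow> (\<forall>x\<in>H. nH x \<le> B * nK (T x))"
    if "bij_betw T H K" for B
    using that by (auto simp: bij_betw_def the_inv_into_f_f)
  then show ?thesis unfolding invertible_op_def bounded_op_def by auto
qed

lemma invertible_op_comp:
  assumes T: "invertible_op H nH K nK T" and S: "invertible_op K nK L nL S"
    and nK: "\<And>y. nK y \<ge> 0"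
  shows "invertible_op H nH L nL (S \<circ> T)"
proof -
  obtain B where B: "bij_betw T H K" "\<And>x. x \<in> H \<Longrightarrow> nH x \<le> B * nK (T x)"
    using T by (auto simp: invertible_op_iff)
  obtain C where C: "bij_betw S K L" "\<And>y. y \<in> K \<Longrightarrow> nK y \<le> C * nL (S y)"
    using S by (auto simp: invertible_op_iff)
  have "nH x \<le> (\<bar>B\<bar> * C) * nL (S (T x))" if x: "x \<in> H" for x
  proof -
    have "nH x \<le> B * nK (T x)" by (rule B(2)[OF x])
    \<comment> \<open>The constant \<open>B\<close> may be negative, and monotonicity in the next
      step needs a nonnegative factor.\<close>
    also have "\<dots> \<le> \<bar>B\<bar> * nK (T x)" by (intro mult_right_mono nK) simp
    also have "\<dots> \<le> \<bar>B\<bar> * (C * nL (S (T x)))"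
      using B(1) x by (intro mult_left_mono C(2)) (auto simp: bij_betw_def)
    finally show ?thesis by (simp add: mult.assoc)
  qed
  then show ?thesis
    unfolding invertible_op_iff using bij_betw_trans[OF B(1) C(1)] by auto
qed

context hilbert_module
begin

text \<open>By \<open>cone_le_of_norm_conj_le\<close> the two order inequalities defining a standard frame amount to
  norm bounds for the analysis operator.\<close>

lemma standard_frame_iff_norm:
  "standard_frame ip X \<longleftrightarrow>
    (\<exists>K. bessel_bound X K) \<and> (\<exists>k. \<forall>x. norm x \<le> k * l2_norm (analysis_op ip X x))"
    (is "_ \<longleftrightarrow> ?U \<and> ?L")
proof -
  let ?T = "analysis_op ip X"
  have sum_eq: "(\<lambda>n. ip x (X n) * ip (X n) x) = (\<lambda>n. ?T x n * star (?T x n))" for x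
    by (simp add: analysis_op_def ip_star)
  have suminf_eq: "(\<Sum>n. ip x (X n) * ip (X n) x) = l2_ip (?T x) (?T x)" for x
    by (simp add: sum_eq l2_ip_def)
  have l2_eq: "summable (\<lambda>n. ip x (X n) * ip (X n) x) \<longleftrightarrow> ?T x \<in> l2" for x
    by (simp add: sum_eq l2_def)
  have pos: "l2_ip (?T x) (?T x) \<in> pos_cone" if "?T x \<in> l2" for x
    unfolding l2_ip_def by (intro cone_suminf mult_star_cone l2_summable that)
  show ?thesis
  proof
    assume "standard_frame ip X"
    then obtain C D where CD: "C > 0" "D > 0" and T: "\<And>x. ?T x \<in> l2"
      and lo: "\<And>x. l2_ip (?T x) (?T x) - C *\<^sub>R ip x x \<in> pos_cone"
      and up: "\<And>x. D *\<^sub>R ip x x - l2_ip (?T x) (?T x) \<in> pos_cone"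
      by (auto simp: standard_frame_def suminf_eq l2_eq cstar_le_iff_cone)
    have "l2_norm (?T x) \<le> sqrt D * norm x" for x
    proof (rule power2_le_imp_le)
      show "(l2_norm (?T x))\<^sup>2 \<le> (sqrt D * norm x)\<^sup>2"
        using cone_norm_mono[OF pos[OF T] up, of x] CD
        by (simp add: l2_norm_power2 power_mult_distrib norm_power2)
    qed (use CD in simp)
    then have "bessel_bound X (sqrt D)" using T CD by (auto simp: bessel_bound_def)
    moreover have "norm x \<le> (1 / sqrt C) * l2_norm (?T x)" for x
    proof (rule power2_le_imp_le)
      have "C * norm (ip x x) \<le> norm (l2_ip (?T x) (?T x))"
        using cone_norm_mono[OF cone_scaleR[OF ip_cone] lo, of x] CD by simp
      then show "(norm x)\<^sup>2 \<le> ((1 / sqrt C) * l2_norm (?T x))\<^sup>2"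
        using CD by (simp add: l2_norm_power2 power_mult_distrib norm_power2 power_divide
            pos_le_divide_eq mult.commute)
    qed (use CD in simp)
    ultimately show "?U \<and> ?L" by blast
  next
    assume "?U \<and> ?L"
    then obtain K k where K: "bessel_bound X K" and k: "\<And>x. norm x \<le> k * l2_norm (?T x)"
      by blast
    note T = bessel_boundD(2)[OF K]
    \<comment> \<open>Conjugation by \<open>a\<close> amounts to replacing \<open>x\<close> by
      \<open>smul a x\<close>, so norm bounds valid for all vectors give the hypothesis of
      \<open>cone_le_of_norm_conj_le\<close>.\<close>
    have conj_T: "norm (a * l2_ip (?T x) (?T x) * star a) = (l2_norm (?T (smul a x)))\<^sup>2" for a x
      by (simp add: l2_norm_power2 analysis_smul l2_ip_mult_left l2_ip_mult_right l2_mult_left T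
          mult.assoc)
    have conj_ip: "norm (a * ip x x * star a) = (norm (smul a x))\<^sup>2" for a x
      by (simp add: norm_power2 ip_smul_left ip_smul_right mult.assoc)
    have up: "(K\<^sup>2 + 1) *\<^sub>R ip x x - l2_ip (?T x) (?T x) \<in> pos_cone" for x
    proof (rule cone_le_of_norm_conj_le)
      fix a
      have "(l2_norm (?T (smul a x)))\<^sup>2 \<le> (K * norm (smul a x))\<^sup>2"
        by (intro power_mono bessel_boundD(3)[OF K] l2_norm_nonneg)
      also have "\<dots> \<le> (K\<^sup>2 + 1) * (norm (smul a x))\<^sup>2"
        by (simp add: power_mult_distrib mult_right_mono)
      finally show "norm (a * l2_ip (?T x) (?T x) * star a) \<le> (K\<^sup>2 + 1) * norm (a * ip x x * star a)"
        by (simp add: conj_T conj_ip)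
    qed (auto intro: ip_cone pos T)
    have "(k\<^sup>2 + 1) *\<^sub>R l2_ip (?T x) (?T x) - ip x x \<in> pos_cone" for x
    proof (rule cone_le_of_norm_conj_le)
      fix a
      have "(norm (smul a x))\<^sup>2 \<le> (k * l2_norm (?T (smul a x)))\<^sup>2"
        by (intro power_mono k norm_ge_zero)
      also have "\<dots> \<le> (k\<^sup>2 + 1) * (l2_norm (?T (smul a x)))\<^sup>2"
        by (simp add: power_mult_distrib mult_right_mono)
      finally show "norm (a * ip x x * star a) \<le> (k\<^sup>2 + 1) * norm (a * l2_ip (?T x) (?T x) * star a)"
        by (simp add: conj_T conj_ip)
    qed (auto intro: ip_cone pos T)
    then have "(1 / (k\<^sup>2 + 1)) *\<^sub>R ((k\<^sup>2 + 1) *\<^sub>R l2_ip (?T x) (?T x) - ip x x) \<in> pos_cone" for x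
      by (rule cone_scaleR) simp
    \<comment> \<open>Adding 1 makes the frame constants strictly positive even if \<open>K\<close>
      or \<open>k\<close> is 0.\<close>
    moreover have pos1: "0 < k\<^sup>2 + 1" "0 < K\<^sup>2 + 1" by (simp_all add: add_nonneg_pos)
    ultimately have lo: "l2_ip (?T x) (?T x) - (1 / (k\<^sup>2 + 1)) *\<^sub>R ip x x \<in> pos_cone" for x
      by (simp add: scaleR_diff_right)
    show "standard_frame ip X"
      unfolding standard_frame_def suminf_eq l2_eq cstar_le_iff_cone
      using lo up T pos1
      by (intro exI[of _ "1 / (k\<^sup>2 + 1)"] exI[of _ "K\<^sup>2 + 1"] conjI allI) auto
  qed
qed

section \<open>The inverse frame operator and the canonical dual\<close>

text \<open>For an operator with \<open>C \<le> S \<le> D\<close> the map \<open>1 - S / D\<close> is a contraction, by the Cauchy-Schwarz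
  inequality for the semi-inner product it induces.\<close>

lemma positive_operator_surj:
  fixes S :: "'e \<Rightarrow> 'e"
  assumes diff: "\<And>x y. S (x - y) = S x - S y"
    and smul: "\<And>a x. S (smul a x) = smul a (S x)"
    and sym: "\<And>x y. ip (S x) y = ip x (S y)"
    and lo: "\<And>x. ip (S x) x - C *\<^sub>R ip x x \<in> pos_cone"
    and up: "\<And>x. D *\<^sub>R ip x x - ip (S x) x \<in> pos_cone"
    and CD: "0 < C" "C \<le> D"
  shows "surj S"
proof -
  define Q where "Q = (\<lambda>x. x - (1 / D) *\<^sub>R S x)"
  define c where "c = 1 - C / D"
  have c: "0 \<le> c" "c < 1" using CD by (simp_all add: c_def)
  have Q_diff: "Q x - Q y = Q (x - y)" for x y
    by (simp add: Q_def diff scaleR_diff_right algebra_simps)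
  have Q_smul: "Q (smul a x) = smul a (Q x)" for a x
    using bounded_linear.linear[OF bounded_linear_smul, THEN linear_diff]
    by (simp add: Q_def smul smul_scaleR_right)
  have ip_scaleR_right: "ip x (r *\<^sub>R y) = r *\<^sub>R ip x y" for r x y
    using ip_scaleR_left[of r y x] by (metis ip_star star_scaleR)
  have Q_sym: "ip (Q x) y = ip x (Q y)" for x y
    by (simp add: Q_def ip_diff_left ip_diff_right ip_scaleR_left ip_scaleR_right sym)
  have Q_pos: "ip (Q x) x \<in> pos_cone" for x
    using cone_scaleR[OF up[of x], of "1 / D"] CD
    by (simp add: Q_def ip_diff_left ip_scaleR_left scaleR_diff_right)
  have "(1 / D) *\<^sub>R (ip (S x) x - C *\<^sub>R ip x x) \<in> pos_cone" for x
    using lo CD by (intro cone_scaleR) auto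
  then have "c *\<^sub>R ip x x - ip (Q x) x \<in> pos_cone" for x
    by (simp add: Q_def c_def ip_diff_left ip_scaleR_left scaleR_diff_right scaleR_diff_left
        algebra_simps)
  then have Q_form: "norm (ip (Q x) x) \<le> c * (norm x)\<^sup>2" for x
    using cone_norm_mono[OF Q_pos, of "c *\<^sub>R ip x x" x] c by (simp add: norm_power2)
  have Q_norm: "norm (Q x) \<le> c * norm x" for x
  proof (cases "Q x = 0")
    case False
    \<comment> \<open>Cauchy-Schwarz for the form \<open>ip (Q x) y\<close> at the pair
      \<open>x\<close>, \<open>Q x\<close>; bounding both factors by \<open>Q_form\<close> leaves
      \<open>(norm (Q x))\<^sup>2\<close> to cancel.\<close>
    have "(norm (ip (Q x) (Q x)))\<^sup>2 \<le> norm (ip (Q x) x) * norm (ip (Q (Q x)) (Q x))"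
    proof (rule cauchy_schwarz_norm)
      fix a
      let ?y = "Q x"
      have "ip (Q x) x - ip (Q x) ?y * star a - a * star (ip (Q x) ?y) + a * ip (Q ?y) ?y * star a
          = ip (Q (x - smul a ?y)) (x - smul a ?y)"
        using Q_sym[of ?y x]
        by (simp add: Q_diff[symmetric] Q_smul ip_diff_left ip_diff_right ip_smul_left
            ip_smul_right ip_star algebra_simps)
      then show "ip (Q x) x - ip (Q x) ?y * star a - a * star (ip (Q x) ?y)
          + a * ip (Q ?y) ?y * star a \<in> pos_cone"
        by (simp add: Q_pos)
    qed (rule Q_pos)
    also have "\<dots> \<le> (c * (norm x)\<^sup>2) * (c * (norm (Q x))\<^sup>2)"
      using c by (intro mult_mono Q_form) auto
    finally have "(norm (Q x))\<^sup>2 * (norm (Q x))\<^sup>2 \<le> (c * norm x)\<^sup>2 * (norm (Q x))\<^sup>2"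
      by (simp add: power2_eq_square algebra_simps flip: norm_power2)
    then have "(norm (Q x))\<^sup>2 \<le> (c * norm x)\<^sup>2"
      by (rule mult_right_le_imp_le) (use False in simp)
    then show ?thesis by (rule power2_le_imp_le) (use c in simp)
  qed (use c in simp)
  have "\<exists>x. y = S x" for y
  proof -
    \<comment> \<open>A fixed point of this contraction satisfies \<open>S x = y\<close>.\<close>
    have "\<exists>!x. (1 / D) *\<^sub>R y + Q x = x"
    proof (rule banach_fix_type[OF c])
      show "\<forall>x z. dist ((1 / D) *\<^sub>R y + Q x) ((1 / D) *\<^sub>R y + Q z) \<le> c * dist x z"
        by (simp add: dist_norm Q_diff Q_norm)
    qed
    then obtain x where "(1 / D) *\<^sub>R y + Q x = x" by blast
    then have "(1 / D) *\<^sub>R y = (1 / D) *\<^sub>R S x" by (simp add: Q_def algebra_simps)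
    then show ?thesis using CD by auto
  qed
  then show ?thesis by (simp add: surj_def)
qed

text \<open>Surjectivity comes from the contraction argument; the lower frame bound with
  Cauchy-Schwarz gives injectivity and the norm bound \<open>1 / C\<close> of the inverse.\<close>

lemma frame_operator_inverse:
  assumes fr: "standard_frame ip X" and K: "bessel_bound X K"
  obtains R where "bounded_linear R" "\<And>a x. R (smul a x) = smul a (R x)"
    "\<And>x y. ip (R x) y = ip x (R y)"
    "\<And>x. synthesis_op smul X (analysis_op ip X (R x)) = x"
    "\<And>x. R (synthesis_op smul X (analysis_op ip X x)) = x"
proof -
  let ?T = "analysis_op ip X"
  define S where "S = (\<lambda>x. synthesis_op smul X (?T x))"
  note T = bessel_boundD(2)[OF K]
  have ip_S: "ip (S x) y = l2_ip (?T x) (?T y)" for x y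
    by (simp add: S_def ip_synthesis[OF K T])
  have ip_S': "ip x (S y) = l2_ip (?T x) (?T y)" for x y
    using ip_S[of y x] by (metis ip_star l2_ip_star[OF T T])
  have S_add: "S (x + y) = S x + S y" for x y
    by (rule ip_eqI_left) (simp add: ip_S analysis_add l2_ip_add_left T ip_add_left)
  have S_smul: "S (smul a x) = smul a (S x)" for a x
    by (rule ip_eqI_left) (simp add: ip_S analysis_smul l2_ip_mult_left T ip_smul_left)
  have S_diff: "S (x - y) = S x - S y" for x y
    using S_add[of "x - y" y] by simp
  have sum_eq: "(\<Sum>n. ip x (X n) * ip (X n) x) = l2_ip (?T x) (?T x)" for x
    by (simp add: l2_ip_def analysis_op_def ip_star)
  obtain C D where CD: "C > 0" "D > 0"
    and lo: "\<And>x. ip (S x) x - C *\<^sub>R ip x x \<in> pos_cone"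
    and up: "\<And>x. D *\<^sub>R ip x x - ip (S x) x \<in> pos_cone"
    using fr by (auto simp: standard_frame_def sum_eq ip_S cstar_le_iff_cone)
  \<comment> \<open>The upper constant is enlarged because \<open>positive_operator_surj\<close>
    asks for \<open>C \<le> D\<close>.\<close>
  have "(C + D) *\<^sub>R ip x x - ip (S x) x \<in> pos_cone" for x
    using cone_add[OF up[of x] cone_scaleR[OF ip_cone[of x], of C]] CD
    by (simp add: scaleR_add_left algebra_simps)
  then have "surj S"
    using CD by (intro positive_operator_surj[OF S_diff S_smul _ lo, where D = "C + D"])
      (simp_all add: ip_S ip_S')
  have below: "C * norm x \<le> norm (S x)" for x
  proof (cases "x = 0")
    case False
    have "norm (C *\<^sub>R ip x x) \<le> norm (ip (S x) x)"
      by (rule cone_norm_mono[OF _ lo]) (use CD in \<open>auto intro: cone_scaleR ip_cone\<close>)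
    also have "\<dots> \<le> norm (S x) * norm x" by (rule cauchy_schwarz)
    finally have "(C * norm x) * norm x \<le> norm (S x) * norm x"
      using CD by (simp add: power2_eq_square flip: norm_power2)
    then show ?thesis by (rule mult_right_le_imp_le) (use False in simp)
  qed simp
  have "inj S"
  proof (rule injI)
    fix x y assume "S x = S y"
    then have "C * norm (x - y) \<le> 0" using below[of "x - y"] by (simp add: S_diff)
    then show "x = y" using CD by (simp add: mult_le_0_iff)
  qed
  define R where "R = inv S"
  have SR: "S (R x) = x" for x using \<open>surj S\<close> by (simp add: R_def surj_f_inv_f)
  have RS: "R (S x) = x" for x using \<open>inj S\<close> by (simp add: R_def)
  have R_smul: "R (smul a x) = smul a (R x)" for a x by (metis SR RS S_smul)
  have "bounded_linear R"
  proof (rule bounded_linear_intro[where K = "1 / C"])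
    show "R (x + y) = R x + R y" for x y by (metis SR RS S_add)
    show "R (r *\<^sub>R x) = r *\<^sub>R R x" for r x by (metis R_smul scaleR_eq)
    show "norm (R x) \<le> norm x * (1 / C)" for x
      using below[of "R x"] CD by (simp add: SR pos_le_divide_eq mult.commute)
  qed
  moreover have "ip (R x) y = ip x (R y)" for x y
    by (metis SR ip_S ip_S')
  ultimately show ?thesis
    using R_smul SR RS by (intro that[of R]) (auto simp: S_def)
qed

text \<open>As \<open>R\<close> is symmetric, the new analysis operator is that of \<open>X\<close>
  after \<open>R\<close>. One reconstruction formula is \<open>SR\<close>; the other arises from
  \<open>RS\<close> by applying \<open>R\<close> termwise. The lower frame bound follows from
  \<open>SR\<close> and boundedness of synthesis.\<close>

lemma canonical_dual:
  assumes fr: "standard_frame ip X" and K: "bessel_bound X K"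
    and R: "bounded_linear R" "\<And>x y. ip (R x) y = ip x (R y)"
    and R_smul: "\<And>a x. R (smul a x) = smul a (R x)"
    and SR: "\<And>x. synthesis_op smul X (analysis_op ip X (R x)) = x"
    and RS: "\<And>x. R (synthesis_op smul X (analysis_op ip X x)) = x"
  shows "dual_frame smul ip X (\<lambda>n. R (X n))"
proof -
  note T = bessel_boundD(2)[OF K]
  have an: "analysis_op ip (\<lambda>n. R (X n)) x = analysis_op ip X (R x)" for x
    by (simp add: analysis_op_def R(2))
  obtain M where M: "\<And>x. norm (R x) \<le> norm x * M" "M > 0"
    using bounded_linear.pos_bounded[OF R(1)] by blast
  have "bessel_bound (\<lambda>n. R (X n)) (K * M)"
    unfolding bessel_bound_def an
  proof (intro conjI allI)
    show "0 \<le> K * M" using M bessel_boundD(1)[OF K] by simp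
    fix x
    have "l2_norm (analysis_op ip X (R x)) \<le> K * norm (R x)" by (rule bessel_boundD(3)[OF K])
    also have "\<dots> \<le> K * (norm x * M)" by (intro mult_left_mono M bessel_boundD(1)[OF K])
    finally show "l2_norm (analysis_op ip X (R x)) \<le> K * M * norm x" by (simp add: ac_simps)
  qed (rule T)
  moreover have "norm x \<le> K * l2_norm (analysis_op ip (\<lambda>n. R (X n)) x)" for x
    using norm_synthesis_le[OF K T, of "R x"] by (simp add: SR an)
  ultimately have "standard_frame ip (\<lambda>n. R (X n))"
    unfolding standard_frame_iff_norm by blast
  moreover have "(\<lambda>n. smul (ip x (R (X n))) (X n)) sums x" for x
    using synthesis_sums[OF K T, of "R x"] by (simp add: SR) (simp add: analysis_op_def R(2))
  moreover have "(\<lambda>n. smul (ip x (X n)) (R (X n))) sums x" for x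
    using bounded_linear.sums[OF R(1) synthesis_sums[OF K T, of x]]
    by (simp add: RS R_smul) (simp add: analysis_op_def)
  ultimately show ?thesis by (simp add: dual_frame_def)
qed

text \<open>The perturbation changes the analysis of \<open>x\<close> by \<open>ip x w\<close> times
  \<open>d\<close>, which synthesis kills. In the other formula the change has the factor
  \<open>l2_ip (analysis_op ip X x) d\<close>, which vanishes by adjointness.\<close>

lemma dual_frame_perturb:
  assumes K: "bessel_bound X K" and Z: "dual_frame smul ip X Z"
    and d: "d \<in> l2" "synthesis_op smul X d = 0"
  shows "dual_frame smul ip X (\<lambda>n. Z n + smul (star (d n)) w)"
proof -
  let ?Z = "\<lambda>n. Z n + smul (star (d n)) w"
  note T = bessel_boundD(2)[OF K]
  obtain L where L: "bessel_bound Z L"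
    using Z by (auto simp: dual_frame_def standard_frame_iff_norm)
  have an: "analysis_op ip ?Z x = (\<lambda>n. analysis_op ip Z x n + ip x w * d n)" for x
    by (simp add: analysis_op_def ip_add_right ip_smul_right star_star)
  have an_l2: "analysis_op ip ?Z x \<in> l2" for x
    unfolding an by (intro l2_add l2_mult_left bessel_boundD(2)[OF L] d(1))
  have bessel: "bessel_bound ?Z (L + norm w * l2_norm d)"
    unfolding bessel_bound_def
  proof (intro conjI allI)
    show "0 \<le> L + norm w * l2_norm d" using bessel_boundD(1)[OF L] by simp
    fix x
    have "l2_norm (analysis_op ip ?Z x) \<le> l2_norm (analysis_op ip Z x) + l2_norm (\<lambda>n. ip x w * d n)"
      unfolding an by (intro l2_norm_triangle l2_mult_left bessel_boundD(2)[OF L] d(1))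
    also have "\<dots> \<le> L * norm x + (norm x * norm w) * l2_norm d"
      by (intro add_mono bessel_boundD(3)[OF L] order_trans[OF l2_norm_mult_left[OF d(1)]]
          mult_right_mono cauchy_schwarz l2_norm_nonneg)
    finally show "l2_norm (analysis_op ip ?Z x) \<le> (L + norm w * l2_norm d) * norm x"
      by (simp add: algebra_simps)
  qed (rule an_l2)
  have rec1: "(\<lambda>n. smul (ip x (?Z n)) (X n)) sums x" for x
  proof -
    have "(\<lambda>n. smul (ip x w) (smul (d n) (X n))) sums 0"
      using bounded_linear.sums[OF bounded_linear_smul synthesis_sums[OF K d(1)], of "ip x w"]
      by (simp add: d(2))
    moreover have "(\<lambda>n. smul (ip x (Z n)) (X n)) sums x"
      using Z by (simp add: dual_frame_def)
    ultimately have "(\<lambda>n. smul (ip x (Z n)) (X n) + smul (ip x w) (smul (d n) (X n))) sums (x + 0)"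
      by (rule sums_add[rotated])
    then show ?thesis
      by (simp add: ip_add_right ip_smul_right star_star smul_add_left smul_smul)
  qed
  have rec2: "(\<lambda>n. smul (ip x (X n)) (?Z n)) sums x" for x
  proof -
    have "star (l2_ip d (analysis_op ip X x)) = star (ip 0 x)"
      using ip_synthesis[OF K d(1), of x] by (simp add: d(2))
    then have "l2_ip (analysis_op ip X x) d = 0"
      using l2_ip_star[OF d(1) T, of x] ip_smul_left[of 0 0 x] by simp
    then have "(\<lambda>n. smul (analysis_op ip X x n * star (d n)) w) sums 0"
      using bounded_linear.sums[OF bounded_linear_smul_left l2_ip_sums[OF T d(1)], of x w] by simp
    moreover have "(\<lambda>n. smul (ip x (X n)) (Z n)) sums x"
      using Z by (simp add: dual_frame_def)
    ultimately have "(\<lambda>n. smul (ip x (X n)) (Z n) + smul (analysis_op ip X x n * star (d n)) w)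
        sums (x + 0)"
      by (rule sums_add[rotated])
    then show ?thesis
      by (simp add: analysis_op_def smul_add_right smul_smul)
  qed
  \<comment> \<open>Reconstruction together with bounded synthesis already yields the lower frame
    bound.\<close>
  have "norm x \<le> K * l2_norm (analysis_op ip ?Z x)" for x
  proof -
    have "synthesis_op smul X (analysis_op ip ?Z x) = x"
      using rec1[of x] by (simp add: synthesis_op_def analysis_op_def sums_iff)
    then show ?thesis using norm_synthesis_le[OF K an_l2, of x] by simp
  qed
  then have "standard_frame ip ?Z"
    using bessel unfolding standard_frame_iff_norm by blast
  then show ?thesis using rec1 rec2 by (simp add: dual_frame_def)
qed

lemma unique_dual_iff_bij_analysis:
  assumes fr: "standard_frame ip X" and w: "\<And>a. smul a w = 0 \<Longrightarrow> a = 0"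
  shows "(\<exists>!Z. dual_frame smul ip X Z) \<longleftrightarrow> bij_betw (analysis_op ip X) UNIV l2"
proof -
  let ?T = "analysis_op ip X"
  obtain K where K: "bessel_bound X K"
    using fr unfolding standard_frame_iff_norm by blast
  obtain k where k: "\<And>x. norm x \<le> k * l2_norm (?T x)"
    using fr unfolding standard_frame_iff_norm by blast
  note T = bessel_boundD(2)[OF K]
  obtain R where R: "bounded_linear R" "\<And>a x. R (smul a x) = smul a (R x)"
    "\<And>x y. ip (R x) y = ip x (R y)"
    "\<And>x. synthesis_op smul X (?T (R x)) = x" "\<And>x. R (synthesis_op smul X (?T x)) = x"
    by (rule frame_operator_inverse[OF fr K]) (rule that)
  have can: "dual_frame smul ip X (\<lambda>n. R (X n))"
    by (rule canonical_dual[OF fr K R(1,3,2,4,5)])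
  have inj: "inj ?T"
    by (metis R(5) injI)
  show ?thesis
  proof
    assume uniq: "\<exists>!Z. dual_frame smul ip X Z"
    have syn_inj: "d n = 0" if d: "d \<in> l2" "synthesis_op smul X d = 0" for d n
    proof -
      \<comment> \<open>Uniqueness identifies the canonical dual with its perturbation, and
        \<open>w\<close> has no annihilator.\<close>
      have "(\<lambda>n. R (X n) + smul (star (d n)) w) = (\<lambda>n. R (X n))"
        using uniq can dual_frame_perturb[OF K can d] by blast
      from fun_cong[OF this, of n] have "star (d n) = 0" by (intro w) simp
      then show ?thesis by (metis star_star star_zero)
    qed
    have "b \<in> range ?T" if b: "b \<in> l2" for b
    proof -
      \<comment> \<open>\<open>c\<close> is the projection of \<open>b\<close> to the range of the
        analysis operator; \<open>b - c\<close> lies in the kernel of synthesis.\<close>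
      define c where "c = ?T (R (synthesis_op smul X b))"
      have c: "c \<in> l2" by (simp add: c_def T)
      have "synthesis_op smul X (\<lambda>n. b n - c n) = 0"
        using synthesis_diff[OF K b c] by (simp add: c_def R(4))
      then have "b n - c n = 0" for n
        using syn_inj[OF l2_diff[OF b c]] by blast
      then have "b = c" by auto
      then show ?thesis by (simp add: c_def)
    qed
    then show "bij_betw ?T UNIV l2"
      using inj T by (auto simp: bij_betw_def)
  next
    assume bij: "bij_betw ?T UNIV l2"
    have "Z n = Z' n" if Z: "dual_frame smul ip X Z" and Z': "dual_frame smul ip X Z'" for Z Z' n
    proof (rule ip_eqI)
      fix x
      have zl: "analysis_op ip W x \<in> l2" "synthesis_op smul X (analysis_op ip W x) = x"
        if "dual_frame smul ip X W" for W
        using that by (auto simp: dual_frame_def standard_frame_iff_norm bessel_bound_def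
            synthesis_op_def analysis_op_def sums_iff)
      define d where "d = (\<lambda>n. analysis_op ip Z x n - analysis_op ip Z' x n)"
      have d: "d \<in> l2" unfolding d_def by (intro l2_diff zl Z Z')
      have "synthesis_op smul X d = 0"
        unfolding d_def using synthesis_diff[OF K zl(1)[OF Z] zl(1)[OF Z']] zl(2) Z Z' by simp
      \<comment> \<open>Writing \<open>d\<close> as the analysis of \<open>u\<close> turns
        \<open>l2_ip d d\<close> into the pairing of the synthesis of \<open>d\<close> with
        \<open>u\<close>, which is 0.\<close>
      moreover obtain u where "?T u = d" using bij d by (metis bij_betw_imp_surj_on rangeE)
      ultimately have "l2_ip d d = 0"
        using ip_synthesis[OF K d, of u] ip_smul_left[of 0 0 u] by simp
      then have "d n = 0" by (intro l2_norm_eq_zero[OF d]) (simp add: l2_norm_def)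
      then show "ip x (Z n) = ip x (Z' n)" by (simp add: d_def analysis_op_def)
    qed
    then have "Z = Z'" if "dual_frame smul ip X Z" "dual_frame smul ip X Z'" for Z Z'
      using that by blast
    then show "\<exists>!Z. dual_frame smul ip X Z" using can by blast
  qed
qed

section \<open>Modular Riesz bases\<close>

text \<open>Uniform boundedness principle for the truncated analysis operators.\<close>

lemma bessel_bound_if_l2:
  assumes l2: "\<And>x. analysis_op ip Y x \<in> l2"
  shows "\<exists>K. bessel_bound Y K"
proof -
  let ?T = "analysis_op ip Y"
  define P where "P = (\<lambda>N x n. if n < N then ?T x n else 0)"
  have P_l2: "P N x \<in> l2" for N x by (rule finite_support_l2[of N]) (simp add: P_def)
  have P_power2: "(l2_norm (P N x))\<^sup>2 = norm (\<Sum>n<N. ?T x n * star (?T x n))" for N x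
    unfolding P_def by (rule l2_norm_truncation)
  have P_le: "l2_norm (P N x) \<le> l2_norm (?T x)" for N x
    by (rule power2_le_imp_le[OF _ l2_norm_nonneg]) (simp add: P_power2 l2_norm_partial_sum l2)
  have P_diff: "l2_norm (P N (x - y)) \<le> l2_norm (P N x) + l2_norm (P N y)" for N x y
  proof -
    have "P N (x - y) = (\<lambda>n. P N x n + (-1) * P N y n)"
      by (auto simp: P_def analysis_op_def ip_diff_left)
    then have "l2_norm (P N (x - y)) \<le> l2_norm (P N x) + l2_norm (\<lambda>n. (-1) * P N y n)"
      using l2_norm_triangle[OF P_l2 l2_mult_left[OF P_l2], of N x "-1" N y] by simp
    also have "l2_norm (\<lambda>n. (-1) * P N y n) \<le> l2_norm (P N y)"
      using l2_norm_mult_left[OF P_l2, of "-1" N y] by simp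
    finally show ?thesis by simp
  qed
  have P_scale: "l2_norm (P N (r *\<^sub>R x)) = \<bar>r\<bar> * l2_norm (P N x)" for N r x
  proof (rule power2_eq_imp_eq)
    have "?T (r *\<^sub>R x) n * star (?T (r *\<^sub>R x) n) = r\<^sup>2 *\<^sub>R (?T x n * star (?T x n))" for n
      by (simp add: analysis_op_def ip_scaleR_left star_scaleR power2_eq_square)
    then show "(l2_norm (P N (r *\<^sub>R x)))\<^sup>2 = (\<bar>r\<bar> * l2_norm (P N x))\<^sup>2"
      by (simp add: P_power2 power_mult_distrib flip: scaleR_right.sum)
  qed auto
  define F where "F = (\<lambda>m::nat. \<Inter>N. {x. norm (\<Sum>n<N. ?T x n * star (?T x n)) \<le> real m})"
  have cont: "continuous_on UNIV (\<lambda>x. norm (\<Sum>n<N. ?T x n * star (?T x n)))" for N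
    unfolding analysis_op_def
    by (intro continuous_intros bounded_linear.continuous_on[OF bounded_linear_ip]
        bounded_linear.continuous_on[OF bounded_linear_star])
  have closed: "closed (F m)" for m
    unfolding F_def by (intro closed_INT ballI closed_Collect_le cont continuous_intros)
  have "x \<in> (\<Union>m. F m)" for x
  proof -
    obtain m :: nat where m: "(l2_norm (?T x))\<^sup>2 \<le> real m" using real_arch_simple by blast
    have "norm (\<Sum>n<N. ?T x n * star (?T x n)) \<le> real m" for N
      by (rule order_trans[OF l2_norm_partial_sum[OF l2 finite_lessThan] m])
    then have "x \<in> F m" by (simp add: F_def)
    then show ?thesis by blast
  qed
  then have union: "(\<Union>m. F m) = UNIV" by blast
  \<comment> \<open>By Baire's theorem the closed sets \<open>F m\<close> covering the space cannot
    all have empty interior.\<close>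
  obtain m where m: "interior (F m) \<noteq> {}"
  proof (rule ccontr)
    assume "\<not> thesis"
    then have "interior (F m) = {}" for m using that by blast
    then have "euclidean interior_of \<Union>(range F) = {}"
      by (intro Baire_category_alt) (auto simp: completely_metrizable_space_euclidean closed)
    then show False using union by simp
  qed
  then obtain x0 e where e: "e > 0" "cball x0 e \<subseteq> F m"
    by (meson all_not_in_conv mem_interior_cball)
  have small: "l2_norm (P N x) \<le> sqrt (real m)" if "x \<in> F m" for N x
    using that by (auto simp: F_def P_power2[symmetric] intro: real_le_rsqrt)
  \<comment> \<open>For \<open>norm y = e\<close> both \<open>x0\<close> and \<open>x0 + y\<close>
    lie in \<open>F m\<close>, so the truncations of \<open>y\<close> have norm at most
    \<open>2 * sqrt (real m)\<close>; scaling to \<open>x\<close> gives \<open>K\<close>.\<close>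
  define K where "K = 2 * sqrt (real m) / e"
  have PK: "l2_norm (P N x) \<le> K * norm x" for N x
  proof (cases "x = 0")
    case True
    then show ?thesis using P_scale[of N 0 x] by simp
  next
    case False
    define y where "y = (e / norm x) *\<^sub>R x"
    have "x0 + y \<in> F m" "x0 \<in> F m"
      using e False by (auto simp: y_def dist_norm intro!: subsetD[OF e(2)])
    then have "l2_norm (P N y) \<le> 2 * sqrt (real m)"
      using P_diff[of N "x0 + y" x0] small[of "x0 + y" N] small[of x0 N] by simp
    then have "e / norm x * l2_norm (P N x) \<le> 2 * sqrt (real m)"
      using e by (simp add: y_def P_scale)
    then show ?thesis using e False by (simp add: K_def field_simps)
  qed
  have "l2_norm (?T x) \<le> K * norm x" for x
  proof (rule power2_le_imp_le)
    have lim: "(\<lambda>N. norm (\<Sum>n<N. ?T x n * star (?T x n))) \<longlonglongrightarrow> (l2_norm (?T x))\<^sup>2"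
      unfolding l2_norm_power2 using l2_ip_sums[OF l2 l2, of x x] by (auto simp: sums_def intro: tendsto_norm)
    show "(l2_norm (?T x))\<^sup>2 \<le> (K * norm x)\<^sup>2"
      by (rule LIMSEQ_le_const2[OF lim])
        (auto intro!: exI[of _ 0] power_mono PK simp flip: P_power2)
    show "0 \<le> K * norm x" using e by (simp add: K_def)
  qed
  moreover have "K \<ge> 0" using e by (simp add: K_def)
  ultimately show ?thesis using l2 by (auto simp: bessel_bound_def)
qed

text \<open>Testing the adjoint of \<open>V\<close> on unit sequences shows that it is the analysis
  operator of \<open>Y\<close>. Its values lie in \<open>l2\<close>, so \<open>Y\<close> has a
  Bessel bound, and \<open>V\<close> agrees with synthesis on \<open>l2\<close> because both have
  the same adjoint.\<close>

lemma modular_riesz_basis_synthesis: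
  assumes "modular_riesz_basis ip Y"
  shows "invertible_op l2 l2_norm UNIV norm (synthesis_op smul Y)" "\<exists>K. bessel_bound Y K"
proof -
  obtain V W where V: "invertible_op l2 l2_norm UNIV norm V" "\<And>n. V (l2_unit n) = Y n"
    and W: "\<And>x. W x \<in> l2" "\<And>a x. a \<in> l2 \<Longrightarrow> ip (V a) x = l2_ip a (W x)"
    using assms unfolding modular_riesz_basis_def l2_adjointable_def by blast
  have W_eq: "W x = analysis_op ip Y x" for x
  proof
    fix n
    have "star (W x n) = star (ip x (Y n))"
      using W(2)[OF l2_unit_l2, of n x] by (simp add: l2_ip_unit V(2) ip_star)
    then show "W x n = analysis_op ip Y x n" by (metis analysis_op_def star_star)
  qed
  then show bes: "\<exists>K. bessel_bound Y K"
    using W(1) by (intro bessel_bound_if_l2) simp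
  then obtain K where K: "bessel_bound Y K" by blast
  have "V a = synthesis_op smul Y a" if "a \<in> l2" for a
    by (rule ip_eqI_left) (simp add: ip_synthesis[OF K that] W(2)[OF that] W_eq)
  then show "invertible_op l2 l2_norm UNIV norm (synthesis_op smul Y)"
    using V(1) unfolding invertible_op_iff by (metis (no_types, lifting) bij_betw_cong)
qed

text \<open>Synthesis is injective and maps the unit sequence multiplied by \<open>a\<close> to
  \<open>smul a (Y n)\<close>. This provides the vector \<open>w\<close> of
  \<open>unique_dual_iff_bij_analysis\<close>.\<close>

lemma modular_riesz_basis_torsion_free:
  assumes Y: "modular_riesz_basis ip Y" and a: "smul a (Y n) = 0"
  shows "a = 0"
proof -
  have "synthesis_op smul Y (\<lambda>k. a * l2_unit n k) = (\<Sum>k\<in>{n}. smul (a * l2_unit n k) (Y k))"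
    unfolding synthesis_op_def by (rule suminf_finite) (auto simp: l2_unit_def)
  then have "synthesis_op smul Y (\<lambda>k. a * l2_unit n k) = synthesis_op smul Y (\<lambda>k. 0)"
    by (simp add: l2_unit_def a) (simp add: synthesis_op_def)
  moreover have "inj_on (synthesis_op smul Y) l2"
    using modular_riesz_basis_synthesis(1)[OF Y] by (simp add: invertible_op_iff bij_betw_def)
  moreover have "(\<lambda>k. 0 :: 'a) \<in> l2" by (rule finite_support_l2) simp
  ultimately have "(\<lambda>k. a * l2_unit n k) = (\<lambda>k. 0)"
    using l2_mult_left[OF l2_unit_l2, of a n] by (blast dest: inj_onD)
  from fun_cong[OF this, of n] show ?thesis by (simp add: l2_unit_def)
qed

end

section \<open>Invertibility of the multiplier and uniqueness of the dual\<close>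

theorem proposition4p5:
  fixes smul :: "'a::unital_cstar_algebra \<Rightarrow> 'e::banach \<Rightarrow> 'e"
    and ip :: "'e \<Rightarrow> 'e \<Rightarrow> 'a"
    and U :: "(nat \<Rightarrow> 'a) \<Rightarrow> (nat \<Rightarrow> 'a)"
    and X Y :: "nat \<Rightarrow> 'e"
  assumes "hilbert_module smul ip"
    and "finitely_generated smul \<or> countably_generated smul"
    and "l2_bounded_operator U"
    and "invertible_op l2 l2_norm l2 l2_norm U"
    and "modular_riesz_basis ip Y"
    and "standard_frame ip X"
  shows "(\<exists>!Z. dual_frame smul ip X Z) \<longleftrightarrow>
         invertible_op UNIV norm UNIV norm (multiplier smul ip U Y X)"
proof -
  interpret hilbert_module smul ip by fact
  let ?T = "analysis_op ip X"
  let ?W = "synthesis_op smul Y \<circ> U"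
  note U = \<open>invertible_op l2 l2_norm l2 l2_norm U\<close>
  have W: "invertible_op l2 l2_norm UNIV norm ?W"
    by (rule invertible_op_comp[OF U modular_riesz_basis_synthesis(1)]) (fact, simp)
  have T: "?T x \<in> l2" for x
    using \<open>standard_frame ip X\<close> by (auto simp: standard_frame_iff_norm bessel_bound_def)
  have lower: "\<exists>k. \<forall>x. norm x \<le> k * l2_norm (?T x)"
    using \<open>standard_frame ip X\<close> by (simp add: standard_frame_iff_norm)
  \<comment> \<open>The bijection \<open>?W\<close> from \<open>l2\<close> cancels in one direction;
    in the other, the lower frame bound supplies boundedness of the inverse of
    \<open>?T\<close>.\<close>
  have "invertible_op UNIV norm UNIV norm (multiplier smul ip U Y X) \<longleftrightarrow> bij_betw ?T UNIV l2"
  proof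
    assume "invertible_op UNIV norm UNIV norm (multiplier smul ip U Y X)"
    then have "bij_betw (?W \<circ> ?T) UNIV UNIV"
      by (simp add: invertible_op_iff multiplier_def)
    moreover have "bij_betw ?W l2 UNIV" using W by (simp add: invertible_op_iff)
    ultimately show "bij_betw ?T UNIV l2"
      using T by (subst bij_betw_comp_iff2) auto
  next
    assume "bij_betw ?T UNIV l2"
    then have "invertible_op UNIV norm l2 l2_norm ?T"
      using lower by (simp add: invertible_op_iff)
    then have "invertible_op UNIV norm UNIV norm (?W \<circ> ?T)"
      by (rule invertible_op_comp[OF _ W]) simp
    then show "invertible_op UNIV norm UNIV norm (multiplier smul ip U Y X)"
      by (simp add: multiplier_def)
  qed
  then show ?thesis
    using unique_dual_iff_bij_analysis[of X "Y 0"] assms modular_riesz_basis_torsion_free by blast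
qed

end
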